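(* Let $\Omega=\bigcup_{i=1}^n(\alpha_i,\beta_i)$ be a finite union of finite open intervals as in the context, let $B=(b_{i,j})$ be a unitary $n\times n$ matrix, and let $\{U(t)\}_{t\in\mathbb R}$ be the unitary group associated to $\Omega$ and the boundary matrix $B$. Let $f\in\mathscr D_B$, $t>0$, and $x\in(\alpha_i,\beta_i)$ for some $1\le i\le n$. If $t<\beta_i-x$, then $[U(t)f](x)=f(x+t)$. If $t\ge\beta_i-x$, then $$[U(t)f](x)=\sum_{\omega=i_1\dots i_m\in\mathcal P_{x,t}}b_\omega\, f(\alpha_{i_m}+r(x,t,\omega))=\sum_{\omega\in\mathcal P_{x,t}}b_\omega\, f(\operatorname{End}(x,t,\omega)).$$ Moreover, if $f\in L^2(\Omega)$ and $t>0$ is fixed, then the formulas above hold for almost every $x\in\Omega$.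
   Context: Setting: $n\ge 1$, $-\infty<\alpha_1<\beta_1<\alpha_2<\beta_2<\dots<\alpha_n<\beta_n<\infty$, $\Omega=\bigcup_{i=1}^n(\alpha_i,\beta_i)$, $l_i=\beta_i-\alpha_i$. $\mathscr D$ is the set of $f\in L^2(\Omega)$ that are absolutely continuous on each interval with $f'\in L^2(\Omega)$; for such $f$, $f(\alpha_i)$ and $f(\beta_i)$ denote the one-sided limits $f(\alpha_i+)$, $f(\beta_i-)$, and $f(\vec\alpha)=(f(\alpha_1),\dots,f(\alpha_n))$, $f(\vec\beta)=(f(\beta_1),\dots,f(\beta_n))$. For a unitary $n\times n$ matrix $B$, $\mathscr D_B=\{f\in\mathscr D: Bf(\vec\alpha)=f(\vec\beta)\}$, and $D_B$ is the operator $D_Bf=\frac1{2\pi \mathrm i}f'$ with domain $\mathscr D_B$; it is self-adjoint on $L^2(\Omega)$. The associated unitary group is $U(t)=\exp(2\pi \mathrm i tD_B)$, $t\in\mathbb R$. It leaves $\mathscr D_B$ invariant, and elements of $\mathscr D_B$ are identified with their continuous representatives, so $[U(t)f](x)$ is defined for every $x\in\Omega$ when $f\in\mathscr D_B$. Admissible paths ($t>0$): for $x\in(\alpha_i,\beta_i)$ and $t>0$, an admissible path for $x$ and $t$ is a finite sequence $\omega=i_1i_2\dots i_m$ of indices in $\{1,\dots,n\}$ such that: $i_1=i$; if $t<\beta_i-x$ then $m=1$; if $t\ge\beta_i-x$ then $m\ge2$ and $$(\beta_i-x)+l_{i_2}+\dots+l_{i_{m-1}}\le t<(\beta_i-x)+l_{i_2}+\dots+l_{i_{m-1}}+l_{i_m}.$$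 If $t\ge\beta_i-x$, the remainder is $r(x,t,\omega)=t-\left((\beta_i-x)+l_{i_2}+\dots+l_{i_{m-1}}\right)\in[0,l_{i_m})$ (for $m=2$ the sum of lengths is empty). Put $b_\omega=b_{i_1,i_2}b_{i_2,i_3}\cdots b_{i_{m-1},i_m}$ and $\operatorname{End}(x,t,\omega)=\alpha_{i_m}+r(x,t,\omega)$. $\mathcal P_{x,t}$ is the (finite) set of all admissible paths for $x$ and $t$. For $f\in\mathscr D_B$ and $r=0$, $f(\alpha_{i_m})$ is the one-sided limit. *)

theory Defs
  imports "HOL-Analysis.Analysis"
begin

text \<open>Elements of \<open>L\<^sup>2(S)\<close> are represented by functions; representatives are compared by
  \<open>ae_eq\<close>, and values outside \<open>S\<close> are irrelevant.\<close>

definition L2 :: "real set \<Rightarrow> (real \<Rightarrow> complex) set" where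
  "L2 S = {f \<in> borel_measurable (lebesgue_on S). integrable (lebesgue_on S) (\<lambda>x. (norm (f x))\<^sup>2)}"

definition ae_eq :: "real set \<Rightarrow> (real \<Rightarrow> complex) \<Rightarrow> (real \<Rightarrow> complex) \<Rightarrow> bool" where
  "ae_eq S f g \<longleftrightarrow> (AE x in lebesgue_on S. f x = g x)"

definition L2_inner :: "real set \<Rightarrow> (real \<Rightarrow> complex) \<Rightarrow> (real \<Rightarrow> complex) \<Rightarrow> complex" where
  "L2_inner S f g = (LINT x|lebesgue_on S. f x * cnj (g x))"

definition L2_norm :: "real set \<Rightarrow> (real \<Rightarrow> complex) \<Rightarrow> real" where
  "L2_norm S f = sqrt (LINT x|lebesgue_on S. (norm (f x))\<^sup>2)"

definition unitary_operator :: "real set \<Rightarrow> ((real \<Rightarrow> complex) \<Rightarrow> (real \<Rightarrow> complex)) \<Rightarrow> bool" where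
  "unitary_operator S T \<longleftrightarrow>
     (\<forall>f\<in>L2 S. T f \<in> L2 S) \<and>
     (\<forall>f\<in>L2 S. \<forall>g\<in>L2 S. ae_eq S f g \<longrightarrow> ae_eq S (T f) (T g)) \<and>
     (\<forall>f\<in>L2 S. \<forall>g\<in>L2 S. ae_eq S (T (\<lambda>x. f x + g x)) (\<lambda>x. T f x + T g x)) \<and>
     (\<forall>f\<in>L2 S. \<forall>c. ae_eq S (T (\<lambda>x. c * f x)) (\<lambda>x. c * T f x)) \<and>
     (\<forall>f\<in>L2 S. \<forall>g\<in>L2 S. L2_inner S (T f) (T g) = L2_inner S f g) \<and>
     (\<forall>g\<in>L2 S. \<exists>f\<in>L2 S. ae_eq S (T f) g)"

definition unitary_group :: "real set \<Rightarrow> (real \<Rightarrow> (real \<Rightarrow> complex) \<Rightarrow> (real \<Rightarrow> complex)) \<Rightarrow> bool" where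
  "unitary_group S U \<longleftrightarrow>
     (\<forall>t. unitary_operator S (U t)) \<and>
     (\<forall>f\<in>L2 S. ae_eq S (U 0 f) f) \<and>
     (\<forall>s t. \<forall>f\<in>L2 S. ae_eq S (U (s + t) f) (U s (U t f))) \<and>
     (\<forall>f\<in>L2 S. \<forall>s. ((\<lambda>t. L2_norm S (\<lambda>x. U t f x - U s f x)) \<longlongrightarrow> 0) (at s))"

definition has_generator_value ::
  "real set \<Rightarrow> (real \<Rightarrow> (real \<Rightarrow> complex) \<Rightarrow> (real \<Rightarrow> complex)) \<Rightarrow>
   (real \<Rightarrow> complex) \<Rightarrow> (real \<Rightarrow> complex) \<Rightarrow> bool" where
  "has_generator_value S U f g \<longleftrightarrow>
     ((\<lambda>h. L2_norm S (\<lambda>x. (U h f x - f x) / complex_of_real h - g x)) \<longlongrightarrow> 0) (at 0)"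

text \<open>\<open>U t = exp (2 \<pi> i t A)\<close> for the (self-adjoint) operator \<open>A\<close> with domain \<open>Dm\<close>: the strongly
  continuous unitary group whose infinitesimal generator is exactly \<open>2 \<pi> i A\<close>, including the equality
  of domains. By Stone's theorem there is, for self-adjoint \<open>A\<close>, one and only one such group.
  \<open>Dm\<close> is a set of representatives, so membership in the domain is taken up to \<open>ae_eq\<close>.\<close>

definition exp_unitary_group ::
  "real set \<Rightarrow> (real \<Rightarrow> complex) set \<Rightarrow> ((real \<Rightarrow> complex) \<Rightarrow> (real \<Rightarrow> complex)) \<Rightarrow>
   (real \<Rightarrow> (real \<Rightarrow> complex) \<Rightarrow> (real \<Rightarrow> complex)) \<Rightarrow> bool" where
  "exp_unitary_group S Dm A U \<longleftrightarrow>
     unitary_group S U \<and>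
     (\<forall>f\<in>L2 S. \<forall>g\<in>L2 S. has_generator_value S U f g \<longleftrightarrow>
        (\<exists>h\<in>Dm. ae_eq S f h \<and> ae_eq S g (\<lambda>x. 2 * of_real pi * \<i> * A h x)))"

text \<open>The intervals are indexed by a finite linearly ordered type \<open>'n\<close>, which plays the role of
  \<open>{1, \<dots>, n}\<close>.\<close>

definition interval_system :: "('n::{finite,linorder} \<Rightarrow> real) \<Rightarrow> ('n \<Rightarrow> real) \<Rightarrow> bool" where
  "interval_system \<alpha> \<beta> \<longleftrightarrow> (\<forall>i. \<alpha> i < \<beta> i) \<and> (\<forall>i j. i < j \<longrightarrow> \<beta> i < \<alpha> j)"

definition Omega :: "('n::finite \<Rightarrow> real) \<Rightarrow> ('n \<Rightarrow> real) \<Rightarrow> real set" where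
  "Omega \<alpha> \<beta> = (\<Union>i. {\<alpha> i<..<\<beta> i})"

definition unitary_matrix :: "complex^'n^'n \<Rightarrow> bool" where
  "unitary_matrix B \<longleftrightarrow>
     (let Bstar = (\<chi> i j. cnj (B $ j $ i)) in B ** Bstar = mat 1 \<and> Bstar ** B = mat 1)"

definition abs_continuous_on :: "real set \<Rightarrow> (real \<Rightarrow> complex) \<Rightarrow> bool" where
  "abs_continuous_on S f \<longleftrightarrow>
     (\<forall>e>0. \<exists>d>0. \<forall>(m::nat) a b.
        (\<forall>k<m. a k \<le> b k \<and> {a k..b k} \<subseteq> S) \<and>
        (\<forall>j<m. \<forall>k<m. j \<noteq> k \<longrightarrow> {a j<..<b j} \<inter> {a k<..<b k} = {}) \<and>
        (\<Sum>k<m. b k - a k) < d \<longrightarrow> (\<Sum>k<m. norm (f (b k) - f (a k))) < e)"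

text \<open>The requirement of differentiability almost everywhere follows from absolute continuity; it
  is listed because \<open>vector_derivative\<close> is unspecified where the derivative does not exist.\<close>

definition D_max :: "('n::finite \<Rightarrow> real) \<Rightarrow> ('n \<Rightarrow> real) \<Rightarrow> (real \<Rightarrow> complex) set" where
  "D_max \<alpha> \<beta> = {f \<in> L2 (Omega \<alpha> \<beta>).
     (\<forall>i. abs_continuous_on {\<alpha> i<..<\<beta> i} f) \<and>
     (AE x in lebesgue_on (Omega \<alpha> \<beta>). f differentiable (at x)) \<and>
     (\<lambda>x. vector_derivative f (at x)) \<in> L2 (Omega \<alpha> \<beta>)}"

definition D_dom ::
  "('n::finite \<Rightarrow> real) \<Rightarrow> ('n \<Rightarrow> real) \<Rightarrow> complex^'n^'n \<Rightarrow> (real \<Rightarrow> complex) set" where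
  "D_dom \<alpha> \<beta> B = {f \<in> D_max \<alpha> \<beta>.
     B *v (\<chi> i. Lim (at_right (\<alpha> i)) f) = (\<chi> i. Lim (at_left (\<beta> i)) f)}"

definition D_op :: "(real \<Rightarrow> complex) \<Rightarrow> real \<Rightarrow> complex" where
  "D_op f x = vector_derivative f (at x) / (2 * of_real pi * \<i>)"

definition associated_unitary_group ::
  "('n::finite \<Rightarrow> real) \<Rightarrow> ('n \<Rightarrow> real) \<Rightarrow> complex^'n^'n \<Rightarrow>
   (real \<Rightarrow> (real \<Rightarrow> complex) \<Rightarrow> (real \<Rightarrow> complex)) \<Rightarrow> bool" where
  "associated_unitary_group \<alpha> \<beta> B U \<longleftrightarrow>
     exp_unitary_group (Omega \<alpha> \<beta>) (D_dom \<alpha> \<beta> B) D_op U"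

text \<open>The value at a point \<open>x\<close> of the open set \<open>S\<close> of the continuous representative of \<open>f\<close>;
  continuous representatives agree on all of \<open>S\<close>.\<close>

definition cont_value :: "real set \<Rightarrow> (real \<Rightarrow> complex) \<Rightarrow> real \<Rightarrow> complex" where
  "cont_value S f x = (THE y. \<exists>h. continuous_on S h \<and> ae_eq S h f \<and> y = h x)"

text \<open>Evaluation extended to left endpoints by the one-sided limit.\<close>

definition eval_ext :: "real set \<Rightarrow> (real \<Rightarrow> complex) \<Rightarrow> real \<Rightarrow> complex" where
  "eval_ext S f y = (if y \<in> S then f y else Lim (at_right y) f)"

text \<open>For \<open>w = i\<^sub>1 \<dots> i\<^sub>m\<close> with \<open>m \<ge> 2\<close>, the list \<open>butlast (tl w)\<close> is \<open>i\<^sub>2 \<dots> i\<^bsub>m-1\<^esub>\<close>; thus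
  \<open>travelled\<close> is the length covered when the last interval is entered.\<close>

definition travelled :: "('n \<Rightarrow> real) \<Rightarrow> ('n \<Rightarrow> real) \<Rightarrow> real \<Rightarrow> 'n list \<Rightarrow> real" where
  "travelled \<alpha> \<beta> x w = (\<beta> (hd w) - x) + (\<Sum>k\<leftarrow>butlast (tl w). \<beta> k - \<alpha> k)"

definition admissible_path ::
  "('n \<Rightarrow> real) \<Rightarrow> ('n \<Rightarrow> real) \<Rightarrow> real \<Rightarrow> real \<Rightarrow> 'n list \<Rightarrow> bool" where
  "admissible_path \<alpha> \<beta> x t w \<longleftrightarrow>
     w \<noteq> [] \<and> x \<in> {\<alpha> (hd w)<..<\<beta> (hd w)} \<and>
     (t < \<beta> (hd w) - x \<longrightarrow> length w = 1) \<and>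
     (t \<ge> \<beta> (hd w) - x \<longrightarrow> length w \<ge> 2 \<and> travelled \<alpha> \<beta> x w \<le> t \<and>
        t < travelled \<alpha> \<beta> x w + (\<beta> (last w) - \<alpha> (last w)))"

definition paths :: "('n \<Rightarrow> real) \<Rightarrow> ('n \<Rightarrow> real) \<Rightarrow> real \<Rightarrow> real \<Rightarrow> 'n list set" where
  "paths \<alpha> \<beta> x t = {w. admissible_path \<alpha> \<beta> x t w}"

definition remainder :: "('n \<Rightarrow> real) \<Rightarrow> ('n \<Rightarrow> real) \<Rightarrow> real \<Rightarrow> real \<Rightarrow> 'n list \<Rightarrow> real" where
  "remainder \<alpha> \<beta> x t w = t - travelled \<alpha> \<beta> x w"

definition path_weight :: "complex^'n^'n \<Rightarrow> 'n list \<Rightarrow> complex" where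
  "path_weight B w = (\<Prod>k<length w - 1. B $ (w ! k) $ (w ! Suc k))"

definition End :: "('n \<Rightarrow> real) \<Rightarrow> ('n \<Rightarrow> real) \<Rightarrow> real \<Rightarrow> real \<Rightarrow> 'n list \<Rightarrow> real" where
  "End \<alpha> \<beta> x t w = \<alpha> (last w) + remainder \<alpha> \<beta> x t w"

end

theory Submission
  imports Defs
begin

text \<open>For times \<open>\<tau>\<close> shorter than every interval, transporting a function along the boundary
  conditions is explicit: the part of \<open>f\<close> pushed out through the left end points \<open>\<alpha>\<^sub>j\<close> re-enters at
  the right end points \<open>\<beta>\<^sub>i\<close> with weights \<open>b\<^sub>i\<^sub>j\<close>. If \<open>f\<close> is \<open>C\<^sup>1\<close> and supported in one interval, the
  transported function is on each interval a translate of a fixed \<open>C\<^sup>1\<close> function, so it stays in the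
  domain of \<open>D\<^sub>B\<close> and solves the evolution equation of the group; by uniqueness it is \<open>U(\<tau>)f\<close>. Such
  functions are total in \<open>L\<^sup>2(\<Omega>)\<close>, and unitarity of \<open>U(\<tau>)\<close> extends the formula to all of \<open>L\<^sup>2(\<Omega>)\<close>.
  Iterating it gives the sum over paths almost everywhere for every \<open>t > 0\<close>. For \<open>f\<close> in the domain of
  \<open>D\<^sub>B\<close> the boundary condition makes that sum continuous in \<open>x\<close>, so it is the continuous
  representative of \<open>U(t)f\<close>.\<close>

section \<open>Square-integrable functions\<close>

lemma L2_measurable: "f \<in> L2 S \<Longrightarrow> f \<in> borel_measurable (lebesgue_on S)"
  and L2_integrable: "f \<in> L2 S \<Longrightarrow> integrable (lebesgue_on S) (\<lambda>x. (norm (f x))\<^sup>2)"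
  by (auto simp: L2_def)

text \<open>The cross term \<open>2 * norm a * norm b\<close> is absorbed by the weighted
  arithmetic-geometric mean inequality. The free weight \<open>e\<close> is what lets integration
  recover the sharp triangle inequality.\<close>

lemma norm_add_sq_le:
  fixes a b :: complex
  assumes "e > 0"
  shows "(norm (a + b))\<^sup>2 \<le> (1 + e) * (norm a)\<^sup>2 + (1 + 1 / e) * (norm b)\<^sup>2"
proof -
  have "(norm (a + b))\<^sup>2 \<le> (norm a + norm b)\<^sup>2"
    by (intro power_mono norm_triangle_ineq) auto
  moreover have "2 * norm a * norm b \<le> e * (norm a)\<^sup>2 + (norm b)\<^sup>2 / e"
  proof -
    have "0 \<le> (e * norm a - norm b)\<^sup>2 / e"
      using assms by auto
    also have "\<dots> = e * (norm a)\<^sup>2 + (norm b)\<^sup>2 / e - 2 * norm a * norm b"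
      using assms by (simp add: field_simps power2_eq_square)
    finally show ?thesis by simp
  qed
  ultimately show ?thesis
    by (simp add: power2_sum algebra_simps)
qed

lemma L2_add:
  assumes "f \<in> L2 S" "g \<in> L2 S"
  shows "(\<lambda>x. f x + g x) \<in> L2 S"
proof -
  have [measurable]: "f \<in> borel_measurable (lebesgue_on S)" "g \<in> borel_measurable (lebesgue_on S)"
    using assms by (auto simp: L2_def)
  have "integrable (lebesgue_on S) (\<lambda>x. (norm (f x + g x))\<^sup>2)"
  proof (rule Bochner_Integration.integrable_bound)
    show "integrable (lebesgue_on S) (\<lambda>x. (1 + 1) * (norm (f x))\<^sup>2 + (1 + 1 / 1) * (norm (g x))\<^sup>2)"
      using assms by (intro Bochner_Integration.integrable_add integrable_mult_right) (auto simp: L2_def)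
    show "AE x in lebesgue_on S. norm ((norm (f x + g x))\<^sup>2)
      \<le> norm ((1 + 1) * (norm (f x))\<^sup>2 + (1 + 1 / 1) * (norm (g x))\<^sup>2)"
      using norm_add_sq_le[of 1] by (auto intro!: AE_I2 order_trans[OF norm_add_sq_le[of 1]])
  qed measurable
  then show ?thesis by (simp add: L2_def)
qed

lemma L2_cmult:
  assumes "f \<in> L2 S"
  shows "(\<lambda>x. c * f x) \<in> L2 S"
  using assms by (auto simp: L2_def norm_mult power_mult_distrib)

lemma L2_divide: "f \<in> L2 S \<Longrightarrow> (\<lambda>x. f x / c) \<in> L2 S"
  using L2_cmult[of f S "1 / c"] by simp

lemma L2_diff:
  assumes "f \<in> L2 S" "g \<in> L2 S"
  shows "(\<lambda>x. f x - g x) \<in> L2 S"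
  using L2_add[OF assms(1) L2_cmult[OF assms(2), of "- 1"]] by simp

lemma ae_eq_refl: "ae_eq S f f"
  by (simp add: ae_eq_def)

lemma ae_eq_sym: "ae_eq S f g \<Longrightarrow> ae_eq S g f"
  unfolding ae_eq_def by (auto elim: eventually_mono)

lemma ae_eq_trans: "ae_eq S f g \<Longrightarrow> ae_eq S g h \<Longrightarrow> ae_eq S f h"
  unfolding ae_eq_def by (auto elim: eventually_elim2)

lemma ae_eq_on: "(\<And>x. x \<in> S \<Longrightarrow> f x = g x) \<Longrightarrow> ae_eq S f g"
  unfolding ae_eq_def by (rule AE_I2) (simp add: space_restrict_space)

lemma L2_norm_cong:
  assumes "ae_eq S f g" "f \<in> L2 S" "g \<in> L2 S"
  shows "L2_norm S f = L2_norm S g"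
proof -
  have [measurable]: "f \<in> borel_measurable (lebesgue_on S)" "g \<in> borel_measurable (lebesgue_on S)"
    using assms by (auto simp: L2_def)
  show ?thesis
    unfolding L2_norm_def using assms(1)
    by (subst integral_cong_AE[where g = "\<lambda>x. (norm (g x))\<^sup>2"]) (auto simp: ae_eq_def elim: eventually_mono)
qed

lemma L2_norm_nonneg: "L2_norm S f \<ge> 0"
  by (simp add: L2_norm_def)

lemma L2_norm_sq: "(L2_norm S f)\<^sup>2 = (LINT x|lebesgue_on S. (norm (f x))\<^sup>2)"
  by (simp add: L2_norm_def)

lemma L2_norm_cmult: "L2_norm S (\<lambda>x. c * f x) = norm c * L2_norm S f"
  by (simp add: L2_norm_def norm_mult power_mult_distrib real_sqrt_mult)

lemma L2_norm_divide: "L2_norm S (\<lambda>x. f x / c) = L2_norm S f / norm c"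
  using L2_norm_cmult[of S "1 / c" f] by (simp add: norm_divide)

lemma L2_norm_minus_commute: "L2_norm S (\<lambda>x. f x - g x) = L2_norm S (\<lambda>x. g x - f x)"
  by (simp add: L2_norm_def norm_minus_commute)

text \<open>Minkowski, without Cauchy--Schwarz: integrate the pointwise bound
  \<open>\<bar>a + b\<bar>\<^sup>2 \<le> (1 + e) \<bar>a\<bar>\<^sup>2 + (1 + 1/e) \<bar>b\<bar>\<^sup>2\<close> with \<open>e = \<parallel>g\<parallel> / \<parallel>f\<parallel>\<close>.\<close>

lemma L2_norm_triangle:
  assumes "f \<in> L2 S" "g \<in> L2 S"
  shows "L2_norm S (\<lambda>x. f x + g x) \<le> L2_norm S f + L2_norm S g"
proof (rule field_le_epsilon)
  fix d :: real assume "d > 0"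
  \<comment> \<open>Padding the norms by \<open>d / 2\<close> makes both positive, so the weight
    \<open>C / A\<close> exists even when a norm vanishes. For this weight the bound below collapses
    to \<open>(A + C)\<^sup>2\<close>.\<close>
  define A where "A = L2_norm S f + d / 2"
  define C where "C = L2_norm S g + d / 2"
  have pos: "A > 0" "C > 0" and le: "L2_norm S f \<le> A" "L2_norm S g \<le> C"
    using \<open>d > 0\<close> L2_norm_nonneg[of S f] L2_norm_nonneg[of S g] by (auto simp: A_def C_def)
  have "(L2_norm S (\<lambda>x. f x + g x))\<^sup>2 \<le>
      (LINT x|lebesgue_on S. (1 + C / A) * (norm (f x))\<^sup>2 + (1 + 1 / (C / A)) * (norm (g x))\<^sup>2)"
    unfolding L2_norm_sq
    using L2_add[OF assms] assms pos
    by (intro integral_mono norm_add_sq_le Bochner_Integration.integrable_add integrable_mult_right)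
      (auto simp: L2_def)
  also have "\<dots> = (1 + C / A) * (L2_norm S f)\<^sup>2 + (1 + A / C) * (L2_norm S g)\<^sup>2"
    unfolding L2_norm_sq using assms by (simp add: L2_def)
  also have "\<dots> \<le> (1 + C / A) * A\<^sup>2 + (1 + A / C) * C\<^sup>2"
    using pos le L2_norm_nonneg by (intro add_mono mult_left_mono power_mono) auto
  also have "\<dots> = (A + C)\<^sup>2"
    using pos by (simp add: field_simps power2_eq_square)
  finally have "L2_norm S (\<lambda>x. f x + g x) \<le> A + C"
    by (rule power2_le_imp_le) (use pos in auto)
  then show "L2_norm S (\<lambda>x. f x + g x) \<le> L2_norm S f + L2_norm S g + d"
    by (simp add: A_def C_def)
qed

lemma L2_norm_diff_triangle:
  assumes "f \<in> L2 S" "g \<in> L2 S" "h \<in> L2 S"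
  shows "L2_norm S (\<lambda>x. f x - h x) \<le> L2_norm S (\<lambda>x. f x - g x) + L2_norm S (\<lambda>x. g x - h x)"
  using L2_norm_triangle[OF L2_diff[OF assms(1,2)] L2_diff[OF assms(2,3)]] by simp

lemma L2_norm_eq_0_iff:
  assumes "f \<in> L2 S" "g \<in> L2 S"
  shows "L2_norm S (\<lambda>x. f x - g x) = 0 \<longleftrightarrow> ae_eq S f g"
proof -
  have "L2_norm S (\<lambda>x. f x - g x) = 0 \<longleftrightarrow> (LINT x|lebesgue_on S. (norm (f x - g x))\<^sup>2) = 0"
    by (simp add: L2_norm_def)
  also have "\<dots> \<longleftrightarrow> (AE x in lebesgue_on S. (norm (f x - g x))\<^sup>2 = 0)"
    by (rule integral_nonneg_eq_0_iff_AE) (use L2_diff[OF assms] in \<open>auto simp: L2_def\<close>)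
  finally show ?thesis by (simp add: ae_eq_def)
qed

lemma L2_bounded:
  assumes "f \<in> borel_measurable (lebesgue_on S)" "S \<in> lmeasurable" "\<And>x. x \<in> S \<Longrightarrow> norm (f x) \<le> C" "C \<ge> 0"
  shows "f \<in> L2 S" and "L2_norm S f \<le> C * sqrt (measure lebesgue S)"
proof -
  have S: "S \<in> sets lebesgue" using assms(2) by auto
  have c: "integrable (lebesgue_on S) (\<lambda>x. C\<^sup>2)"
  proof -
    have "finite_measure (lebesgue_on S)"
      by (rule finite_measureI)
        (use assms(2) in \<open>auto simp: space_restrict_space emeasure_restrict_space fmeasurable_def\<close>)
    then show ?thesis by (simp add: finite_measure.integrable_const)
  qed
  have le: "(norm (f x))\<^sup>2 \<le> C\<^sup>2" if "x \<in> S" for x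
    using assms that by (intro power_mono) auto
  have i: "integrable (lebesgue_on S) (\<lambda>x. (norm (f x))\<^sup>2)"
    by (rule Bochner_Integration.integrable_bound[OF c])
      (use assms le in \<open>auto intro!: AE_I2 simp: space_restrict_space\<close>)
  show "f \<in> L2 S" using i assms by (simp add: L2_def)
  have "(L2_norm S f)\<^sup>2 \<le> (LINT x|lebesgue_on S. C\<^sup>2)"
    unfolding L2_norm_sq by (intro integral_mono i c le) (simp add: space_restrict_space)
  also have "\<dots> = (C * sqrt (measure lebesgue S))\<^sup>2"
    using assms S by (simp add: measure_restrict_space power_mult_distrib)
  finally show "L2_norm S f \<le> C * sqrt (measure lebesgue S)"
    by (rule power2_le_imp_le) (use assms in auto)
qed

section \<open>Unitary operators as linear isometries on almost-everywhere classes\<close>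

context
  fixes S :: "real set" and T :: "(real \<Rightarrow> complex) \<Rightarrow> (real \<Rightarrow> complex)"
  assumes T: "unitary_operator S T"
begin

lemma unitary_L2: "f \<in> L2 S \<Longrightarrow> T f \<in> L2 S"
  and unitary_cong: "f \<in> L2 S \<Longrightarrow> g \<in> L2 S \<Longrightarrow> ae_eq S f g \<Longrightarrow> ae_eq S (T f) (T g)"
  and unitary_add: "f \<in> L2 S \<Longrightarrow> g \<in> L2 S \<Longrightarrow> ae_eq S (T (\<lambda>x. f x + g x)) (\<lambda>x. T f x + T g x)"
  and unitary_cmult: "f \<in> L2 S \<Longrightarrow> ae_eq S (T (\<lambda>x. c * f x)) (\<lambda>x. c * T f x)"
  using T by (auto simp: unitary_operator_def)

lemma unitary_norm: "f \<in> L2 S \<Longrightarrow> L2_norm S (T f) = L2_norm S f"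
proof -
  assume f: "f \<in> L2 S"
  have *: "L2_inner S g g = complex_of_real ((L2_norm S g)\<^sup>2)" for g
    unfolding L2_norm_sq L2_inner_def
    by (simp add: complex_norm_square[symmetric] flip: integral_complex_of_real)
  have "L2_inner S (T f) (T f) = L2_inner S f f"
    using T f by (auto simp: unitary_operator_def)
  then have "(L2_norm S (T f))\<^sup>2 = (L2_norm S f)\<^sup>2"
    unfolding * of_real_eq_iff .
  then show ?thesis
    by (simp add: L2_norm_nonneg)
qed

lemma unitary_diff:
  assumes "f \<in> L2 S" "g \<in> L2 S"
  shows "ae_eq S (T (\<lambda>x. f x - g x)) (\<lambda>x. T f x - T g x)"
  using unitary_add[OF assms(1) L2_cmult[OF assms(2), of "-1"]] unitary_cmult[OF assms(2), of "-1"]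
  unfolding ae_eq_def by (auto elim: eventually_elim2)

lemma unitary_norm_diff:
  assumes "f \<in> L2 S" "g \<in> L2 S"
  shows "L2_norm S (\<lambda>x. T f x - T g x) = L2_norm S (\<lambda>x. f x - g x)"
  using L2_norm_cong[OF unitary_diff[OF assms]] unitary_norm[OF L2_diff[OF assms]]
    unitary_L2 L2_diff assms by simp

end

section \<open>Orbits of unitary groups\<close>

lemma unitary_group_L2:
  assumes "unitary_group S U" "f \<in> L2 S"
  shows "U t f \<in> L2 S"
  using assms unitary_L2 by (auto simp: unitary_group_def)

text \<open>Uniqueness for the abstract Cauchy problem: the real function \<open>s \<mapsto> \<parallel>w s - U s (w 0)\<parallel>\<close>
  has derivative \<open>0\<close>, because its increments are bounded by \<open>\<parallel>w (s + h) - U h (w s)\<parallel>\<close>.\<close>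

lemma unitary_group_orbit:
  fixes w w' :: "real \<Rightarrow> real \<Rightarrow> complex"
  assumes U: "unitary_group S U"
    and w: "\<And>s. w s \<in> L2 S" and w': "\<And>s. w' s \<in> L2 S"
    and gen: "\<And>s. 0 < s \<Longrightarrow> s < T \<Longrightarrow> has_generator_value S U (w s) (w' s)"
    and deriv: "\<And>s. 0 \<le> s \<Longrightarrow> s < T \<Longrightarrow>
      ((\<lambda>h. L2_norm S (\<lambda>x. (w (s + h) x - w s x) / complex_of_real h - w' s x)) \<longlongrightarrow> 0) (at 0)"
    and \<tau>: "0 \<le> \<tau>" "\<tau> < T"
  shows "ae_eq S (w \<tau>) (U \<tau> (w 0))"
proof -
  have op: "unitary_operator S (U t)" for t
    using U by (auto simp: unitary_group_def)
  define f where "f = w 0"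
  have f: "f \<in> L2 S" by (simp add: f_def w)
  note UL2 = unitary_group_L2[OF U]
  \<comment> \<open>Differentiability of \<open>w\<close> at \<open>0\<close> gives continuity
    there: the increment is \<open>h\<close> times a difference quotient whose norm stays
    bounded.\<close>
  have "((\<lambda>h. L2_norm S (\<lambda>x. w h x - w 0 x)) \<longlongrightarrow> 0) (at 0)"
  proof (rule Lim_null_comparison)
    let ?a = "\<lambda>h. L2_norm S (\<lambda>x. (w h x - w 0 x) / complex_of_real h - w' 0 x)"
    show "((\<lambda>h. \<bar>h\<bar> * (?a h + L2_norm S (w' 0))) \<longlongrightarrow> 0) (at 0)"
    proof -
      have "(?a \<longlongrightarrow> 0) (at 0)"
        using deriv[of 0] \<tau> by simp
      then have "((\<lambda>h. \<bar>h\<bar> * (?a h + L2_norm S (w' 0))) \<longlongrightarrow> \<bar>0\<bar> * (0 + L2_norm S (w' 0))) (at 0)"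
        by (intro tendsto_intros)
      then show ?thesis by simp
    qed
    show "\<forall>\<^sub>F h in at 0. norm (L2_norm S (\<lambda>x. w h x - w 0 x)) \<le> \<bar>h\<bar> * (?a h + L2_norm S (w' 0))"
    proof (rule eventually_at_filter[THEN iffD2], rule always_eventually, intro allI impI)
      fix h :: real assume h: "h \<noteq> 0"
      have "L2_norm S (\<lambda>x. (w h x - w 0 x) / complex_of_real h) \<le> ?a h + L2_norm S (w' 0)"
        using L2_norm_triangle[of "\<lambda>x. (w h x - w 0 x) / complex_of_real h - w' 0 x" S "w' 0"]
        by (simp add: L2_divide L2_diff w w')
      then have "L2_norm S (\<lambda>x. w h x - w 0 x) \<le> \<bar>h\<bar> * (?a h + L2_norm S (w' 0))"
        unfolding L2_norm_divide norm_of_real using h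
        by (subst mult.commute) (rule pos_divide_le_eq[THEN iffD1], simp_all only: zero_less_abs_iff not_False_eq_True)
      then show "norm (L2_norm S (\<lambda>x. w h x - w 0 x)) \<le> \<bar>h\<bar> * (?a h + L2_norm S (w' 0))"
        by (simp only: real_norm_def abs_of_nonneg[OF L2_norm_nonneg])
    qed
  qed
  then have cont: "((\<lambda>h. L2_norm S (\<lambda>x. w h x - w 0 x)) \<longlongrightarrow> 0) (at_right 0)"
    by (rule tendsto_mono[OF at_le[OF subset_UNIV]])
  have U0: "ae_eq S (U 0 f) f"
    using U f by (auto simp: unitary_group_def)
  define \<psi> where "\<psi> s = L2_norm S (\<lambda>x. w s x - U s f x)" for s
  \<comment> \<open>Since \<open>U h\<close> is an isometry, \<open>\<psi> s\<close> is also the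
    distance from \<open>U h (w s)\<close> to \<open>U h (U s f)\<close>; two triangle inequalities
    compare it with \<open>\<psi> (s + h)\<close>.\<close>
  have incr: "\<bar>\<psi> (s + h) - \<psi> s\<bar> \<le> L2_norm S (\<lambda>x. w (s + h) x - U h (w s) x)" for s h
  proof -
    let ?N = "\<lambda>f g. L2_norm S (\<lambda>x. f x - g x)"
    have "ae_eq S (U (s + h) f) (U h (U s f))"
      using U f by (simp add: unitary_group_def add.commute)
    then have e: "?N (U (s + h) f) g = ?N (U h (U s f)) g" if "g \<in> L2 S" for g
      using that by (intro L2_norm_cong L2_diff UL2 f) (auto simp: ae_eq_def)
    have p: "\<psi> (s + h) = ?N (w (s + h)) (U h (U s f))"
      unfolding \<psi>_def using e[OF w[of "s+h"]] by (metis L2_norm_minus_commute)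
    have q: "\<psi> s = ?N (U h (w s)) (U h (U s f))"
      unfolding \<psi>_def by (rule unitary_norm_diff[OF op w UL2[OF f], symmetric])
    have "\<psi> (s + h) \<le> ?N (w (s + h)) (U h (w s)) + \<psi> s"
      unfolding p q by (intro L2_norm_diff_triangle w UL2 f)
    moreover have "\<psi> s \<le> ?N (U h (w s)) (w (s + h)) + \<psi> (s + h)"
      unfolding p q by (intro L2_norm_diff_triangle w UL2 f)
    ultimately show ?thesis
      by (simp add: L2_norm_minus_commute[of S "w (s + h)"])
  qed
  \<comment> \<open>The difference quotients of \<open>w\<close> and of the orbit through
    \<open>w s\<close> have the same limit \<open>w' s\<close>, so the bound in \<open>incr\<close>
    is of smaller order than \<open>h\<close>.\<close>
  have DERIV: "DERIV \<psi> s :> 0" if s: "0 < s" "s < T" for s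
    unfolding DERIV_def
  proof (rule Lim_null_comparison)
    let ?a = "\<lambda>h. L2_norm S (\<lambda>x. (w (s + h) x - w s x) / complex_of_real h - w' s x)"
    let ?b = "\<lambda>h. L2_norm S (\<lambda>x. (U h (w s) x - w s x) / complex_of_real h - w' s x)"
    show "((\<lambda>h. ?a h + ?b h) \<longlongrightarrow> 0) (at 0)"
      using tendsto_add[OF deriv[OF less_imp_le[OF s(1)] s(2)] gen[OF s, unfolded has_generator_value_def]] by simp
    show "\<forall>\<^sub>F h in at 0. norm ((\<psi> (s + h) - \<psi> s) / h) \<le> ?a h + ?b h"
    proof (rule eventually_at_filter[THEN iffD2], rule always_eventually, intro allI impI)
      fix h :: real assume "h \<noteq> 0"
      have "norm ((\<psi> (s + h) - \<psi> s) / h) \<le>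
          L2_norm S (\<lambda>x. w (s + h) x - U h (w s) x) / norm (complex_of_real h)"
        using incr[of s h] by (simp add: divide_right_mono)
      also have "\<dots> = L2_norm S (\<lambda>x. (w (s + h) x - w s x) / complex_of_real h
          - (U h (w s) x - w s x) / complex_of_real h)"
        by (subst L2_norm_divide[symmetric]) (simp add: diff_divide_distrib)
      also have "\<dots> \<le> ?a h + ?b h"
        using L2_norm_diff_triangle[of "\<lambda>x. (w (s + h) x - w s x) / complex_of_real h" S "w' s"
          "\<lambda>x. (U h (w s) x - w s x) / complex_of_real h"]
        by (simp add: L2_norm_minus_commute[of S "w' s"] L2_divide L2_diff w w' UL2)
      finally show "norm ((\<psi> (s + h) - \<psi> s) / h) \<le> ?a h + ?b h" .
    qed
  qed
  have \<psi>0: "\<psi> 0 = 0"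
    unfolding \<psi>_def using L2_norm_eq_0_iff[OF w[of 0] UL2[OF f, of 0]] ae_eq_sym[OF U0]
    by (simp only: f_def)
  \<comment> \<open>The generator condition is available only for \<open>0 < s\<close>. At the left
    end, right continuity takes the place of the derivative; it comes from continuity of
    \<open>w\<close> at \<open>0\<close> and strong continuity of \<open>U\<close>.\<close>
  have at0: "(\<psi> \<longlongrightarrow> \<psi> 0) (at_right 0)"
    unfolding \<psi>0
  proof (rule Lim_null_comparison)
    have "((\<lambda>t. L2_norm S (\<lambda>x. U t f x - U 0 f x)) \<longlongrightarrow> 0) (at_right 0)"
      by (rule tendsto_mono[OF at_le[OF subset_UNIV]]) (use U f in \<open>auto simp: unitary_group_def\<close>)
    from tendsto_add[OF cont this]
    show "((\<lambda>t. L2_norm S (\<lambda>x. w t x - w 0 x) + L2_norm S (\<lambda>x. U t f x - U 0 f x)) \<longlongrightarrow> 0) (at_right 0)"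
      by simp
    show "\<forall>\<^sub>F t in at_right 0. norm (\<psi> t) \<le>
        L2_norm S (\<lambda>x. w t x - w 0 x) + L2_norm S (\<lambda>x. U t f x - U 0 f x)"
    proof (rule always_eventually, rule allI)
      fix t
      have "L2_norm S (\<lambda>x. U t f x - U 0 f x) = L2_norm S (\<lambda>x. U t f x - f x)"
        by (intro L2_norm_cong L2_diff UL2 f) (use U0 in \<open>auto simp: ae_eq_def\<close>)
      moreover have "\<psi> t \<le> L2_norm S (\<lambda>x. w t x - f x) + L2_norm S (\<lambda>x. f x - U t f x)"
        unfolding \<psi>_def by (intro L2_norm_diff_triangle w UL2 f)
      ultimately show "norm (\<psi> t) \<le>
          L2_norm S (\<lambda>x. w t x - w 0 x) + L2_norm S (\<lambda>x. U t f x - U 0 f x)"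
        using L2_norm_nonneg[of S "\<lambda>x. w t x - U t f x"] L2_norm_minus_commute[of S f "U t f"]
        unfolding \<psi>_def real_norm_def f_def by linarith
    qed
  qed
  have "\<psi> \<tau> = 0"
  proof (cases "\<tau> = 0")
    case False
    have "continuous_on {0..\<tau>} \<psi>"
    proof (rule continuous_on_IccI)
      show "(\<psi> \<longlongrightarrow> \<psi> 0) (at_right 0)" by (rule at0)
      show "(\<psi> \<longlongrightarrow> \<psi> \<tau>) (at_left \<tau>)" "\<And>s. 0 < s \<Longrightarrow> s < \<tau> \<Longrightarrow> \<psi> \<midarrow>s\<rightarrow> \<psi> s"
        using DERIV[THEN DERIV_isCont] False \<tau>
        by (auto simp: isCont_def filterlim_at_split)
    qed (use False \<tau> in auto)
    moreover have "0 < \<tau>" using False \<tau> by simp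
    moreover have "DERIV \<psi> s :> 0" if "0 < s" "s < \<tau>" for s
      using DERIV that \<tau> by simp
    ultimately have "\<psi> \<tau> = \<psi> 0" by (intro DERIV_isconst_end)
    then show ?thesis using \<psi>0 by simp
  qed (use \<psi>0 in simp)
  then show ?thesis
    unfolding \<psi>_def f_def using L2_norm_eq_0_iff[OF w[of \<tau>] UL2[OF w[of 0], of \<tau>]] by simp
qed

section \<open>Translates as orbits\<close>

lemma L2_cong_on:
  assumes "f \<in> L2 S" "\<And>x. x \<in> S \<Longrightarrow> f x = g x"
  shows "g \<in> L2 S"
proof -
  have "f \<in> borel_measurable (lebesgue_on S) \<longleftrightarrow> g \<in> borel_measurable (lebesgue_on S)"
    by (rule measurable_cong) (use assms in \<open>simp add: space_restrict_space\<close>)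
  moreover have "integrable (lebesgue_on S) (\<lambda>x. (norm (f x))\<^sup>2) \<longleftrightarrow> integrable (lebesgue_on S) (\<lambda>x. (norm (g x))\<^sup>2)"
    by (rule Bochner_Integration.integrable_cong) (use assms in \<open>simp_all add: space_restrict_space\<close>)
  ultimately show ?thesis using assms(1) by (simp add: L2_def)
qed

text \<open>A bounded derivative makes \<open>f\<close> Lipschitz, so the increments over the small
  intervals add up to at most the Lipschitz constant times their total length.\<close>

lemma abs_continuous_on_bounded_derivative:
  fixes f :: "real \<Rightarrow> complex"
  assumes S: "convex S"
    and deriv: "\<And>x. x \<in> S \<Longrightarrow> (f has_vector_derivative f' x) (at x within S)"
    and bound: "\<And>x. x \<in> S \<Longrightarrow> norm (f' x) \<le> C"
  shows "abs_continuous_on S f"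
  unfolding abs_continuous_on_def
proof (intro allI impI)
  fix e :: real assume "e > 0"
  \<comment> \<open>Linearising at \<open>a\<close> costs \<open>2 * C\<close> for the variation of
    \<open>f'\<close> and \<open>C\<close> for the linear term; the absolute value and the added
    \<open>1\<close> make \<open>D\<close> positive.\<close>
  define D where "D = 3 * \<bar>C\<bar> + 1"
  have D: "D > 0" by (simp add: D_def)
  have lip: "norm (f b - f a) \<le> D * (b - a)" if "a \<le> b" "{a..b} \<subseteq> S" for a b
  proof -
    have a: "a \<in> S" using that by auto
    have "norm (f b - f a - (b - a) *\<^sub>R f' a) \<le> norm (b - a) * (2 * C)"
    proof (rule vector_differentiable_bound_linearization[OF deriv])
      show "norm (f' x - f' a) \<le> 2 * C" if "x \<in> S" for x
        using norm_triangle_ineq4[of "f' x" "f' a"] bound[OF that] bound[OF a] by simp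
    qed (use that a in \<open>auto simp: closed_segment_eq_real_ivl\<close>)
    moreover have "norm ((b - a) *\<^sub>R f' a) \<le> (b - a) * C"
      using bound[OF a] that by (simp add: mult_left_mono)
    moreover have "norm (b - a) * (2 * C) = 2 * ((b - a) * C)" using that by simp
    ultimately have "norm (f b - f a) \<le> 3 * ((b - a) * C)"
      using norm_triangle_sub[of "f b - f a" "(b - a) *\<^sub>R f' a"] by linarith
    also have "\<dots> = (3 * C) * (b - a)"
      by (simp add: algebra_simps)
    also have "\<dots> \<le> D * (b - a)"
      using that by (intro mult_right_mono) (auto simp: D_def)
    finally show ?thesis .
  qed
  show "\<exists>d>0. \<forall>(m::nat) a b.
        (\<forall>k<m. a k \<le> b k \<and> {a k..b k} \<subseteq> S) \<and>
        (\<forall>j<m. \<forall>k<m. j \<noteq> k \<longrightarrow> {a j<..<b j} \<inter> {a k<..<b k} = {}) \<and>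
        (\<Sum>k<m. b k - a k) < d \<longrightarrow> (\<Sum>k<m. norm (f (b k) - f (a k))) < e"
  proof (intro exI[of _ "e / D"] conjI allI impI)
    fix m :: nat and a b
    assume *: "(\<forall>k<m. a k \<le> b k \<and> {a k..b k} \<subseteq> S) \<and>
        (\<forall>j<m. \<forall>k<m. j \<noteq> k \<longrightarrow> {a j<..<b j} \<inter> {a k<..<b k} = {}) \<and>
        (\<Sum>k<m. b k - a k) < e / D"
    have "(\<Sum>k<m. norm (f (b k) - f (a k))) \<le> (\<Sum>k<m. D * (b k - a k))"
      using * by (intro sum_mono lip) auto
    also have "\<dots> = D * (\<Sum>k<m. b k - a k)"
      by (simp add: sum_distrib_left)
    also have "\<dots> < e"
      using * D by (simp add: field_simps)
    finally show "(\<Sum>k<m. norm (f (b k) - f (a k))) < e" .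
  qed (use \<open>e > 0\<close> D in auto)
qed

text \<open>The mean value inequality between \<open>x\<close> and \<open>x + h\<close> bounds the
  error by the oscillation of \<open>G'\<close> there. Uniform continuity on the compact interval
  \<open>{a - 1..b + 1}\<close>, which contains \<open>x + h\<close> for \<bar>h\<bar> < 1, makes it
  small for all \<open>x\<close> at once.\<close>

lemma uniform_vector_derivative:
  fixes G G' :: "real \<Rightarrow> complex"
  assumes deriv: "\<And>x. (G has_vector_derivative G' x) (at x)" and cont: "continuous_on UNIV G'"
    and "e > 0"
  shows "\<forall>\<^sub>F h in at 0. \<forall>x\<in>{a..b}. norm ((G (x + h) - G x) / complex_of_real h - G' x) \<le> e"
proof -
  have "uniformly_continuous_on {a - 1..b + 1} G'"
    by (intro compact_uniformly_continuous continuous_on_subset[OF cont]) auto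
  then obtain d where d: "d > 0" "\<And>x y. x \<in> {a-1..b+1} \<Longrightarrow> y \<in> {a-1..b+1} \<Longrightarrow>
      dist y x < d \<Longrightarrow> dist (G' y) (G' x) < e"
    using \<open>e > 0\<close> unfolding uniformly_continuous_on_def by meson
  have "\<forall>\<^sub>F h in at (0::real). h \<noteq> 0 \<and> \<bar>h\<bar> < min d 1"
    unfolding eventually_at using d by (intro exI[of _ "min d 1"]) (auto simp: dist_real_def)
  then show ?thesis
  proof (rule eventually_mono, intro ballI)
    fix h x assume h: "h \<noteq> 0 \<and> \<bar>h\<bar> < min d 1" and x: "x \<in> {a..b}"
    let ?S = "closed_segment x (x + h)"
    have near: "\<bar>y - x\<bar> \<le> \<bar>h\<bar>" if "y \<in> ?S" for y
      using that by (auto simp: closed_segment_eq_real_ivl split: if_splits)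
    have "norm (G (x + h) - G x - (x + h - x) *\<^sub>R G' x) \<le> norm (x + h - x) * e"
    proof (rule vector_differentiable_bound_linearization)
      show "norm (G' y - G' x) \<le> e" if "y \<in> ?S" for y
        using near[OF that] h x d(2)[of x y] by (auto simp: dist_norm abs_le_iff less_imp_le)
    qed (use deriv in \<open>auto intro: has_vector_derivative_at_within\<close>)
    moreover have "(G (x + h) - G x) / complex_of_real h - G' x =
        (G (x + h) - G x - h *\<^sub>R G' x) / complex_of_real h"
      using h by (simp add: scaleR_conv_of_real diff_divide_distrib)
    ultimately show "norm ((G (x + h) - G x) / complex_of_real h - G' x) \<le> e"
      using h by (simp add: norm_divide field_simps)
  qed
qed

section \<open>Functions given by one formula on each interval\<close>

locale boundary_unitary_group =
  fixes \<alpha> \<beta> :: "'n::{finite,linorder} \<Rightarrow> real"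
    and B :: "complex^('n::{finite,linorder})^('n::{finite,linorder})"
    and U :: "real \<Rightarrow> (real \<Rightarrow> complex) \<Rightarrow> (real \<Rightarrow> complex)"
  assumes sys: "interval_system \<alpha> \<beta>"
    and assoc: "associated_unitary_group \<alpha> \<beta> B U"
begin

abbreviation "I i \<equiv> {\<alpha> i<..<\<beta> i}"
abbreviation "\<Omega> \<equiv> Omega \<alpha> \<beta>"

lemma endpoint_less: "\<alpha> i < \<beta> i"
  and endpoint_sep: "i < j \<Longrightarrow> \<beta> i < \<alpha> j"
  using sys by (auto simp: interval_system_def)

text \<open>Closed intervals are taken because a point that re-enters may sit exactly on a left end
  point.\<close>

lemma disjoint: "y \<in> {\<alpha> k..\<beta> k} \<Longrightarrow> k \<noteq> j \<Longrightarrow> y \<notin> {\<alpha> j..\<beta> j}"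
  using endpoint_sep[of k j] endpoint_sep[of j k] by (cases k j rule: linorder_cases) auto

lemma index_unique: "x \<in> I i \<Longrightarrow> x \<in> I j \<Longrightarrow> i = j"
  using disjoint[of x i j] by auto

lemma I_subset: "x \<in> I i \<Longrightarrow> x \<in> \<Omega>"
  by (auto simp: Omega_def)

lemma open_\<Omega>: "open \<Omega>"
  by (auto simp: Omega_def)

lemma lmeasurable_\<Omega>: "\<Omega> \<in> lmeasurable"
  unfolding Omega_def by (intro fmeasurable.finite_UN) (auto simp: lmeasurable_interval)

lemma sets_\<Omega>: "\<Omega> \<in> sets lebesgue"
  using lmeasurable_\<Omega> by auto

definition min_length :: real where "min_length = Min (range (\<lambda>i. \<beta> i - \<alpha> i))"

lemma min_length_pos: "min_length > 0"
  unfolding min_length_def using endpoint_less by (subst Min_gr_iff) auto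

lemma min_length_le: "min_length \<le> \<beta> i - \<alpha> i"
  unfolding min_length_def by (intro Min_le) auto

lemma U_group: "unitary_group \<Omega> U"
  using assoc by (simp add: associated_unitary_group_def exp_unitary_group_def)

lemma U_op: "unitary_operator \<Omega> (U t)"
  using U_group by (simp add: unitary_group_def)

lemmas U_L2 = unitary_L2[OF U_op] and U_cong = unitary_cong[OF U_op]

text \<open>The sum with indicators lets measurability and pointwise limits pass through term by
  term; the result vanishes off \<Omega>.\<close>

definition glue :: "('n \<Rightarrow> real \<Rightarrow> complex) \<Rightarrow> real \<Rightarrow> complex" where
  "glue G x = (\<Sum>i\<in>UNIV. indicator (I i) x * G i x)"

lemma glue_eq: "x \<in> I i \<Longrightarrow> glue G x = G i x"
proof -
  assume x: "x \<in> I i"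
  have "glue G x = (\<Sum>k\<in>UNIV. if k = i then G i x else 0)"
    unfolding glue_def using x index_unique by (intro sum.cong) (auto simp: indicator_def)
  then show ?thesis by simp
qed

lemma glue_measurable:
  assumes "\<And>i. G i \<in> borel_measurable lebesgue"
  shows "glue G \<in> borel_measurable lebesgue"
  unfolding glue_def using assms by (intro borel_measurable_sum borel_measurable_times borel_measurable_indicator) auto

lemma glue_L2:
  assumes "\<And>i. continuous_on UNIV (G i)"
  shows "glue G \<in> L2 \<Omega>"
proof -
  have "\<forall>i. \<exists>C. \<forall>x\<in>{\<alpha> i..\<beta> i}. norm (G i x) \<le> C"
  proof
    fix i
    have "compact (G i ` {\<alpha> i..\<beta> i})"
      by (intro compact_continuous_image continuous_on_subset[OF assms]) auto
    then show "\<exists>C. \<forall>x\<in>{\<alpha> i..\<beta> i}. norm (G i x) \<le> C"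
      by (auto dest!: compact_imp_bounded simp: bounded_iff)
  qed
  then obtain C where C: "\<And>i x. x \<in> {\<alpha> i..\<beta> i} \<Longrightarrow> norm (G i x) \<le> C i" by metis
  have "glue G \<in> borel_measurable lebesgue"
    using assms by (intro glue_measurable) (auto intro!: measurable_completion borel_measurable_continuous_onI)
  moreover have "norm (glue G x) \<le> (\<Sum>i\<in>UNIV. \<bar>C i\<bar>)" if "x \<in> \<Omega>" for x
  proof -
    from that obtain i where i: "x \<in> I i" by (auto simp: Omega_def)
    have "norm (glue G x) \<le> \<bar>C i\<bar>"
      using C[of x i] i by (auto simp: glue_eq[OF i])
    also have "\<dots> \<le> (\<Sum>i\<in>UNIV. \<bar>C i\<bar>)"
      by (intro member_le_sum) auto
    finally show ?thesis .
  qed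
  ultimately show ?thesis
    by (intro L2_bounded(1)[OF _ lmeasurable_\<Omega>]) (auto intro!: measurable_restrict_space1 sum_nonneg)
qed

text \<open>As \<open>s\<close> grows, values of \<open>F i\<close> from beyond \<beta> i slide into
  the fixed interval and those near \<alpha> i leave it, so what each profile does outside its own
  interval matters.\<close>

abbreviation "glue_shift F s \<equiv> glue (\<lambda>i x. F i (x + s))"

section \<open>Sliding a family of C^1 profiles through the intervals\<close>

context
  fixes G G' :: "'n \<Rightarrow> real \<Rightarrow> complex"
  assumes deriv: "\<And>i x. (G i has_vector_derivative G' i x) (at x)"
    and cont: "\<And>i. continuous_on UNIV (G' i)"
begin

lemma cont_G: "continuous_on UNIV (G i)"
  using deriv has_vector_derivative_continuous by (blast intro: continuous_at_imp_continuous_on)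

lemma glue_shift_L2: "glue_shift G s \<in> L2 \<Omega>" "glue_shift G' s \<in> L2 \<Omega>"
  by (intro glue_L2 continuous_on_compose2[OF cont_G] continuous_on_compose2[OF cont] continuous_intros; simp)+

lemma deriv_shift: "((\<lambda>x. G i (x + s)) has_vector_derivative G' i (x + s)) (at x)"
  using vector_diff_chain_at[of "\<lambda>x. x + s" 1 x "G i" "G' i (x + s)"] deriv
    has_vector_derivative_add_const[of "\<lambda>x. x" s 1 "at x"]
  by (auto simp: o_def)

lemma glue_shift_deriv:
  assumes "x \<in> I i"
  shows "(glue_shift G s has_vector_derivative glue_shift G' s x) (at x)"
  unfolding glue_eq[OF assms]
  by (rule has_vector_derivative_transform_within_open[OF deriv_shift, of "I i"])
    (use assms in \<open>auto simp: glue_eq\<close>)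

lemma glue_shift_vector_derivative:
  assumes "x \<in> \<Omega>"
  shows "vector_derivative (glue_shift G s) (at x) = glue_shift G' s x"
proof -
  from assms obtain i where "x \<in> I i" by (auto simp: Omega_def)
  from glue_shift_deriv[OF this] show ?thesis by (rule vector_derivative_at)
qed

text \<open>The difference quotients converge uniformly on each of the finitely many intervals, and
  uniform convergence on a set of finite measure implies convergence in L2.\<close>

lemma glue_shift_L2_deriv:
  "((\<lambda>h. L2_norm \<Omega> (\<lambda>x. (glue_shift G (s + h) x - glue_shift G s x) / complex_of_real h - glue_shift G' s x)) \<longlongrightarrow> 0) (at 0)"
proof (rule tendstoI)
  fix e :: real assume e: "e > 0"
  define m where "m = sqrt (measure lebesgue \<Omega>)"
  have m: "m \<ge> 0" by (simp add: m_def)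
  define d where "d = e / (m + 1)"
  have d: "d > 0" using e m by (simp add: d_def)
  have "\<forall>\<^sub>F h in at 0. \<forall>i. \<forall>x\<in>{\<alpha> i + s..\<beta> i + s}.
      norm ((G i (x + h) - G i x) / complex_of_real h - G' i x) \<le> d"
    by (intro eventually_all_finite uniform_vector_derivative deriv cont d)
  then show "\<forall>\<^sub>F h in at 0. dist (L2_norm \<Omega> (\<lambda>x. (glue_shift G (s + h) x - glue_shift G s x) / complex_of_real h - glue_shift G' s x)) 0 < e"
  proof eventually_elim
    case (elim h)
    let ?q = "\<lambda>x. (glue_shift G (s + h) x - glue_shift G s x) / complex_of_real h - glue_shift G' s x"
    have "norm (?q x) \<le> d" if "x \<in> \<Omega>" for x
    proof -
      from that obtain i where i: "x \<in> I i" by (auto simp: Omega_def)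
      then show ?thesis using bspec[OF spec[OF elim, of i], of "x + s"] by (simp add: glue_eq[OF i] ac_simps)
    qed
    moreover have "?q \<in> L2 \<Omega>"
      by (intro L2_diff L2_divide glue_shift_L2)
    ultimately have "L2_norm \<Omega> ?q \<le> d * m"
      unfolding m_def using d by (intro L2_bounded(2)[OF L2_measurable lmeasurable_\<Omega>]) auto
    also have "\<dots> < e" using e m by (simp add: d_def field_simps)
    finally show ?case using L2_norm_nonneg[of \<Omega>] by simp
  qed
qed

text \<open>The one-sided limits are the values of \<open>G i\<close> at
  \<open>\<alpha> i + s\<close> and \<open>\<beta> i + s\<close>, which turns the boundary condition
  into \<open>bc\<close>. Absolute continuity holds because \<open>G' i\<close> is bounded on
  compact sets.\<close>

lemma glue_shift_D_dom:
  assumes bc: "\<And>i. (\<Sum>k\<in>UNIV. B $ i $ k * G k (\<alpha> k + s)) = G i (\<beta> i + s)"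
  shows "glue_shift G s \<in> D_dom \<alpha> \<beta> B"
proof -
  have ac: "abs_continuous_on (I i) (glue_shift G s)" for i
  proof -
    have "compact (G' i ` {\<alpha> i + s..\<beta> i + s})"
      by (intro compact_continuous_image continuous_on_subset[OF cont]) auto
    then obtain C where C: "\<forall>x\<in>{\<alpha> i + s..\<beta> i + s}. norm (G' i x) \<le> C"
      by (auto dest!: compact_imp_bounded simp: bounded_iff)
    show ?thesis
    proof (rule abs_continuous_on_bounded_derivative)
      show "(glue_shift G s has_vector_derivative glue_shift G' s x) (at x within I i)" if "x \<in> I i" for x
        using glue_shift_deriv[OF that] by (rule has_vector_derivative_at_within)
      show "norm (glue_shift G' s x) \<le> C" if "x \<in> I i" for x
        using C that by (simp add: glue_eq)
    qed auto
  qed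
  have ad: "AE x in lebesgue_on \<Omega>. glue_shift G s differentiable (at x)"
    by (rule AE_I2) (auto simp: Omega_def space_restrict_space intro!: differentiableI_vector glue_shift_deriv)
  have l2: "(\<lambda>x. vector_derivative (glue_shift G s) (at x)) \<in> L2 \<Omega>"
    by (rule L2_cong_on[OF glue_shift_L2(2)[of s]]) (simp add: glue_shift_vector_derivative)
  have t: "((\<lambda>x. G i (x + s)) \<longlongrightarrow> G i (y + s)) (at y within S)" for i y S
    by (rule tendsto_within_subset[OF _ subset_UNIV])
      (use has_vector_derivative_continuous[OF deriv_shift] in \<open>auto simp: continuous_at\<close>)
  have limr: "Lim (at_right (\<alpha> i)) (glue_shift G s) = G i (\<alpha> i + s)" for i
  proof (rule tendsto_Lim)
    have "\<forall>\<^sub>F x in at_right (\<alpha> i). x \<in> I i"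
      using eventually_at_right_real[OF endpoint_less[of i]] by simp
    then show "(glue_shift G s \<longlongrightarrow> G i (\<alpha> i + s)) (at_right (\<alpha> i))"
      by (intro Lim_transform_eventually[OF t]) (auto elim!: eventually_mono simp: glue_eq)
  qed simp
  have liml: "Lim (at_left (\<beta> i)) (glue_shift G s) = G i (\<beta> i + s)" for i
  proof (rule tendsto_Lim)
    have "\<forall>\<^sub>F x in at_left (\<beta> i). x \<in> I i"
      using eventually_at_left_real[OF endpoint_less[of i]] by simp
    then show "(glue_shift G s \<longlongrightarrow> G i (\<beta> i + s)) (at_left (\<beta> i))"
      by (intro Lim_transform_eventually[OF t]) (auto elim!: eventually_mono simp: glue_eq)
  qed simp
  show ?thesis
    unfolding D_dom_def D_max_def
    using glue_shift_L2(1) ac ad l2 bc by (simp add: limr liml vec_eq_iff matrix_vector_mult_def)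
qed

text \<open>The constant in \<open>D_op\<close> cancels against
  \<open>2 * of_real pi * \<i>\<close>, so on the domain the generator is plain
  differentiation.\<close>

lemma glue_shift_generator:
  assumes "\<And>i. (\<Sum>k\<in>UNIV. B $ i $ k * G k (\<alpha> k + s)) = G i (\<beta> i + s)"
  shows "has_generator_value \<Omega> U (glue_shift G s) (glue_shift G' s)"
proof -
  have "ae_eq \<Omega> (glue_shift G' s) (\<lambda>x. 2 * of_real pi * \<i> * D_op (glue_shift G s) x)"
    by (intro ae_eq_on) (simp add: D_op_def glue_shift_vector_derivative)
  then show ?thesis
    using assoc glue_shift_L2 glue_shift_D_dom[OF assms] ae_eq_refl
    unfolding associated_unitary_group_def exp_unitary_group_def by blast
qed

end

end

section \<open>Small times\<close>

lemma AE_translate: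
  fixes c :: real
  assumes "AE x in lebesgue. P x"
  shows "AE x in lebesgue. P (x + c)"
proof -
  from assms obtain N where N: "{x. \<not> P x} \<subseteq> N" "negligible N"
    by (auto simp: eventually_ae_filter negligible_iff_null_sets)
  have "{x. \<not> P (x + c)} \<subseteq> (+) (- c) ` N"
  proof
    fix x assume "x \<in> {x. \<not> P (x + c)}"
    then have "x + c \<in> N" using N(1) by auto
    then show "x \<in> (+) (- c) ` N" by (intro image_eqI[of _ _ "x + c"]) auto
  qed
  with negligible_translation[OF N(2), of "- c"] show ?thesis
    by (auto simp: eventually_ae_filter negligible_iff_null_sets)
qed

lemma AE_not_in_finite: "finite F \<Longrightarrow> AE x in lebesgue. (x::real) \<notin> F"
  using negligible_finite[of F] by (auto simp: eventually_ae_filter negligible_iff_null_sets)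

text \<open>Squaring removes the corner of the positive part: at \<open>0\<close> the difference
  quotient is at most \<bar>h\<bar>. This gives \<open>bump\<close> a continuous derivative across
  the ends of its interval.\<close>

lemma has_real_derivative_max_0_sq:
  "((\<lambda>y::real. (max 0 y)\<^sup>2) has_real_derivative 2 * max 0 y) (at y)"
proof -
  consider "y > 0" | "y < 0" | "y = 0" by linarith
  then show ?thesis
  proof cases
    case 1
    have "((\<lambda>y::real. y\<^sup>2) has_real_derivative 2 * max 0 y) (at y)"
      using 1 by (auto intro!: derivative_eq_intros)
    then show ?thesis
      by (rule has_field_derivative_transform_within_open[of _ _ _ "{0<..}"]) (use 1 in auto)
  next
    case 2
    have "((\<lambda>y::real. 0) has_real_derivative 2 * max 0 y) (at y)"
      using 2 by auto
    then show ?thesis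
      by (rule has_field_derivative_transform_within_open[of _ _ _ "{..<0}"]) (use 2 in auto)
  next
    case 3
    have "(\<lambda>h::real. (max 0 h)\<^sup>2 / h) \<midarrow>0\<rightarrow> 0"
    proof (rule Lim_null_comparison)
      show "\<forall>\<^sub>F h::real in at 0. norm ((max 0 h)\<^sup>2 / h) \<le> \<bar>h\<bar>"
        by (rule always_eventually) (auto simp: max_def power2_eq_square)
    qed (auto intro!: tendsto_eq_intros)
    then show ?thesis using 3 by (simp add: DERIV_def)
  qed
qed

text \<open>A \<open>C\<^sup>1\<close> function vanishing outside \<open>(a, b)\<close>; it increases to the indicator of \<open>(a, b)\<close> as \<open>e\<close>
  decreases to \<open>0\<close>.\<close>

definition bump :: "real \<Rightarrow> real \<Rightarrow> real \<Rightarrow> real \<Rightarrow> real" where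
  "bump a b e x = (max 0 ((x - a) * (b - x)))\<^sup>2 / (e + (max 0 ((x - a) * (b - x)))\<^sup>2)"

lemma bump_eq_0:
  assumes "x \<notin> {a<..<b}" "a < b"
  shows "bump a b e x = 0"
proof -
  have "(x - a) * (b - x) \<le> 0"
    using assms by (auto simp: mult_le_0_iff)
  then show ?thesis by (simp add: bump_def max_absorb1)
qed

lemma bump_bounds: "e > 0 \<Longrightarrow> 0 \<le> bump a b e x" "e > 0 \<Longrightarrow> bump a b e x \<le> 1"
  by (auto simp: bump_def divide_le_eq_1 intro: add_pos_nonneg)

lemma bump_derivative:
  assumes "e > 0"
  obtains u' where "\<And>x. (bump a b e has_real_derivative u' x) (at x)" "continuous_on UNIV u'"
proof
  let ?p = "\<lambda>x. (x - a) * (b - x)"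
  let ?s = "\<lambda>x. (max 0 (?p x))\<^sup>2"
  let ?s' = "\<lambda>x. 2 * max 0 (?p x) * ((b - x) - (x - a))"
  have ne: "e + ?s x \<noteq> 0" for x
    using add_pos_nonneg[OF assms zero_le_power2] by (metis less_irrefl)
  have p: "(?p has_real_derivative ((b - x) - (x - a))) (at x)" for x
    by (auto intro!: derivative_eq_intros)
  have s: "(?s has_real_derivative ?s' x) (at x)" for x
    using DERIV_chain2[OF has_real_derivative_max_0_sq p] by simp
  show "(bump a b e has_real_derivative (?s' x * (e + ?s x) - ?s x * (0 + ?s' x)) / ((e + ?s x) * (e + ?s x))) (at x)" for x
    unfolding bump_def[abs_def]
    by (intro DERIV_divide s DERIV_add DERIV_const ne)
  show "continuous_on UNIV (\<lambda>x. (?s' x * (e + ?s x) - ?s x * (0 + ?s' x)) / ((e + ?s x) * (e + ?s x)))"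
    using ne by (intro continuous_intros) auto
qed

lemma bump_LIMSEQ:
  assumes "a < b"
  shows "(\<lambda>k. bump a b (inverse (real (Suc k))) x) \<longlonglongrightarrow> indicator {a<..<b} x"
proof (cases "x \<in> {a<..<b}")
  case True
  define s where "s = (max 0 ((x - a) * (b - x)))\<^sup>2"
  have "s > 0" using True by (simp add: s_def max_def)
  then have "(\<lambda>k. s / (inverse (real (Suc k)) + s)) \<longlonglongrightarrow> s / (0 + s)"
    by (intro tendsto_intros LIMSEQ_inverse_real_of_nat) auto
  then show ?thesis using True \<open>s > 0\<close> by (simp add: bump_def s_def)
qed (use assms in \<open>simp add: bump_eq_0\<close>)

section \<open>Transport over a time shorter than every interval\<close>

context boundary_unitary_group
begin

text \<open>For times shorter than every interval, a point crosses at most one right endpoint.\<close>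

definition hop :: "real \<Rightarrow> (real \<Rightarrow> complex) \<Rightarrow> real \<Rightarrow> complex" where
  "hop \<tau> f = glue (\<lambda>i x. if x + \<tau> < \<beta> i then f (x + \<tau>)
     else (\<Sum>j\<in>UNIV. B $ i $ j * f (\<alpha> j + (x + \<tau> - \<beta> i))))"

lemma hop_eq:
  "x \<in> I i \<Longrightarrow> hop \<tau> f x = (if x + \<tau> < \<beta> i then f (x + \<tau>)
     else (\<Sum>j\<in>UNIV. B $ i $ j * f (\<alpha> j + (x + \<tau> - \<beta> i))))"
  by (simp add: hop_def glue_eq)

lemma AE_\<Omega>: "(AE x in lebesgue_on \<Omega>. P x) \<longleftrightarrow> (AE x in lebesgue. x \<in> \<Omega> \<longrightarrow> P x)"
  using sets_\<Omega> by (subst AE_restrict_space_iff) auto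

lemma \<Omega>E: assumes "x \<in> \<Omega>" obtains i where "x \<in> I i"
  using assms by (auto simp: Omega_def)

text \<open>\<open>hop\<close> reads its argument only at translates of \<open>x\<close>, by \<tau>
  or by one of the finitely many \<open>\<alpha> j + \<tau> - \<beta> i\<close>, and translations
  preserve null sets.\<close>

lemma AE_hop_points:
  assumes "AE y in lebesgue_on \<Omega>. P y" "0 \<le> \<tau>" "\<tau> < min_length"
  shows "AE x in lebesgue_on \<Omega>. \<forall>i. x \<in> I i \<longrightarrow>
    (if x + \<tau> < \<beta> i then P (x + \<tau>)
     else \<forall>j. \<alpha> j + (x + \<tau> - \<beta> i) \<in> I j \<and> P (\<alpha> j + (x + \<tau> - \<beta> i)))"
proof -
  have P: "AE x in lebesgue. x \<in> \<Omega> \<longrightarrow> P x"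
    using assms(1) by (simp add: AE_\<Omega>)
  have "AE x in lebesgue. \<forall>i j. x + (\<alpha> j + \<tau> - \<beta> i) \<in> \<Omega> \<longrightarrow> P (x + (\<alpha> j + \<tau> - \<beta> i))"
    by (intro AE_all_countable[THEN iffD2] allI AE_translate[OF P])
  moreover have "AE x in lebesgue. x + \<tau> \<in> \<Omega> \<longrightarrow> P (x + \<tau>)"
    by (rule AE_translate[OF P])
  \<comment> \<open>These finitely many points arrive exactly at a right end point; they would
    re-enter at \<alpha> j itself, which lies outside the open interval.\<close>
  moreover have "AE x in lebesgue. x \<notin> range (\<lambda>i. \<beta> i - \<tau>)"
    by (rule AE_not_in_finite) simp
  ultimately have "AE x in lebesgue. x \<in> \<Omega> \<longrightarrow> (\<forall>i. x \<in> I i \<longrightarrow>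
    (if x + \<tau> < \<beta> i then P (x + \<tau>)
     else \<forall>j. \<alpha> j + (x + \<tau> - \<beta> i) \<in> I j \<and> P (\<alpha> j + (x + \<tau> - \<beta> i))))"
  proof eventually_elim
    case (elim x)
    show ?case
    proof (intro impI allI)
      fix i assume x: "x \<in> I i"
      show "if x + \<tau> < \<beta> i then P (x + \<tau>)
        else \<forall>j. \<alpha> j + (x + \<tau> - \<beta> i) \<in> I j \<and> P (\<alpha> j + (x + \<tau> - \<beta> i))"
      proof (cases "x + \<tau> < \<beta> i")
        case True
        then have "x + \<tau> \<in> I i" using x assms by auto
        then show ?thesis using True elim(2) I_subset by auto
      next
        case False
        have y: "\<alpha> j + (x + \<tau> - \<beta> i) \<in> I j" for j
        proof -
          have "x \<noteq> \<beta> i - \<tau>" using elim(3) by auto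
          then show ?thesis using False x assms min_length_le[of j] by auto
        qed
        moreover have "P (\<alpha> j + (x + \<tau> - \<beta> i))" for j
          using elim(1)[rule_format, of j i] I_subset[OF y[of j]] by (simp add: algebra_simps)
        ultimately show ?thesis using False by simp
      qed
    qed
  qed
  then show ?thesis by (simp add: AE_\<Omega>)
qed

lemma hop_cong:
  assumes "ae_eq \<Omega> f g" "0 \<le> \<tau>" "\<tau> < min_length"
  shows "ae_eq \<Omega> (hop \<tau> f) (hop \<tau> g)"
  unfolding ae_eq_def
proof -
  have "AE x in lebesgue_on \<Omega>. x \<in> \<Omega>"
    by (rule AE_I2) (simp add: space_restrict_space)
  moreover note AE_hop_points[OF assms(1)[unfolded ae_eq_def] assms(2,3)]
  ultimately show "AE x in lebesgue_on \<Omega>. hop \<tau> f x = hop \<tau> g x"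
  proof eventually_elim
    case (elim x)
    from elim(1) obtain i where i: "x \<in> I i" by (rule \<Omega>E)
    then show ?case using elim(2) by (auto simp: hop_eq[OF i] split: if_splits intro!: sum.cong)
  qed
qed

lemma hop_smooth:
  assumes deriv: "\<And>x. (\<phi> has_vector_derivative \<phi>' x) (at x)"
    and cont: "continuous_on UNIV \<phi>'"
    and supp: "\<And>x. x \<notin> I j \<Longrightarrow> \<phi> x = 0"
    and \<tau>: "0 \<le> \<tau>" "\<tau> < min_length"
  shows "\<phi> \<in> L2 \<Omega>" and "ae_eq \<Omega> (U \<tau> \<phi>) (hop \<tau> \<phi>)"
proof -
  \<comment> \<open>The profile for \<open>I i\<close> has \<phi> in place if \<open>i = j\<close>,
    and a copy of \<phi> weighted by \<open>B $ i $ j\<close> waiting just beyond \<beta> i. The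
    copy is what re-enters while \<phi> is pushed out through \<alpha> j; at time \<open>0\<close>
    it is still outside \<open>I i\<close>.\<close>
  define G where "G i x = (if i = j then \<phi> x else 0) + B $ i $ j * \<phi> (x + (\<alpha> j - \<beta> i))" for i x
  define G' where "G' i x = (if i = j then \<phi>' x else 0) + B $ i $ j * \<phi>' (x + (\<alpha> j - \<beta> i))" for i x
  have G: "(G i has_vector_derivative G' i x) (at x)" for i x
  proof -
    have "((\<lambda>x. \<phi> (x + c)) has_vector_derivative \<phi>' (x + c)) (at x)" for c
      by (rule deriv_shift[of "\<lambda>_. \<phi>" "\<lambda>_. \<phi>'", OF deriv cont])
    then have "((\<lambda>x. B $ i $ j * \<phi> (x + (\<alpha> j - \<beta> i))) has_vector_derivative
        B $ i $ j * \<phi>' (x + (\<alpha> j - \<beta> i))) (at x)"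
      by (rule has_vector_derivative_mult_right)
    moreover have "((\<lambda>x. if i = j then \<phi> x else 0) has_vector_derivative (if i = j then \<phi>' x else 0)) (at x)"
      using deriv by auto
    ultimately show ?thesis
      unfolding G_def G'_def by (rule has_vector_derivative_add[rotated])
  qed
  have G': "continuous_on UNIV (G' i)" for i
  proof -
    have "continuous_on UNIV (\<lambda>x. \<phi>' (x + c))" for c
      by (rule continuous_on_compose2[OF cont]) (auto intro!: continuous_intros)
    then show ?thesis
      unfolding G'_def by (cases "i = j") (auto intro!: continuous_intros cont)
  qed
  define w where "w s = glue (\<lambda>i x. G i (x + s))" for s
  define w' where "w' s = glue (\<lambda>i x. G' i (x + s))" for s
  have "ae_eq \<Omega> (w \<tau>) (U \<tau> (w 0))"
  proof (rule unitary_group_orbit[where w' = w' and T = min_length])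
    show "unitary_group \<Omega> U" by (rule U_group)
    show "w s \<in> L2 \<Omega>" "w' s \<in> L2 \<Omega>" for s
      unfolding w_def w'_def using glue_shift_L2[of G G', OF G G'] by auto
    show "has_generator_value \<Omega> U (w s) (w' s)" if s: "0 < s" "s < min_length" for s
      unfolding w_def w'_def
    proof (rule glue_shift_generator[of G G', OF G G'])
      fix i
      \<comment> \<open>For \<open>s\<close> below every length, the copy waiting beyond \<beta> k
        has not come down to \<alpha> k, so left end points see \<phi> alone. At the right end
        points only the copy contributes, and the two sides of the boundary condition agree.\<close>
      have "G k (\<alpha> k + s) = (if k = j then \<phi> (\<alpha> j + s) else 0)" for k
        using s min_length_le[of k] supp[of "\<alpha> k + s + (\<alpha> j - \<beta> k)"] by (simp add: G_def)
      then have "(\<Sum>k\<in>UNIV. B $ i $ k * G k (\<alpha> k + s)) = (\<Sum>k\<in>UNIV. if k = j then B $ i $ j * \<phi> (\<alpha> j + s) else 0)"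
        by (intro sum.cong) auto
      also have "\<dots> = G i (\<beta> i + s)"
        using s supp[of "\<beta> j + s"] by (simp add: G_def add_ac)
      finally show "(\<Sum>k\<in>UNIV. B $ i $ k * G k (\<alpha> k + s)) = G i (\<beta> i + s)" .
    qed
    show "((\<lambda>h. L2_norm \<Omega> (\<lambda>x. (w (s + h) x - w s x) / complex_of_real h - w' s x)) \<longlongrightarrow> 0) (at 0)" for s
      unfolding w_def w'_def by (rule glue_shift_L2_deriv[of G G', OF G G'])
  qed (use \<tau> in auto)
  moreover have w0: "w 0 x = \<phi> x" if "x \<in> \<Omega>" for x
  proof -
    from that obtain i where i: "x \<in> I i" by (rule \<Omega>E)
    then have "\<phi> (x + (\<alpha> j - \<beta> i)) = 0" by (intro supp) auto
    moreover have "\<phi> x = 0" if "i \<noteq> j"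
      using that i index_unique by (intro supp) blast
    ultimately show ?thesis by (auto simp: w_def glue_eq[OF i] G_def)
  qed
  \<comment> \<open>Before the crossing only the first term of \<open>G i\<close> can be nonzero,
    after it only the weighted copy; these are the two branches of \<open>hop\<close>.\<close>
  moreover have "w \<tau> x = hop \<tau> \<phi> x" if "x \<in> \<Omega>" for x
  proof -
    from that obtain i where i: "x \<in> I i" by (rule \<Omega>E)
    show ?thesis
    proof (cases "x + \<tau> < \<beta> i")
      case True
      then have "\<phi> (x + \<tau> + (\<alpha> j - \<beta> i)) = 0" by (intro supp) auto
      moreover have "\<phi> (x + \<tau>) = 0" if "i \<noteq> j"
      proof (rule supp)
        have "x + \<tau> \<in> I i" using True i \<tau> by auto
        then show "x + \<tau> \<notin> I j" using that index_unique by blast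
      qed
      ultimately show ?thesis using True by (auto simp: hop_eq[OF i] w_def glue_eq[OF i] G_def)
    next
      case False
      have "\<phi> (\<alpha> k + (x + \<tau> - \<beta> i)) = 0" if "k \<noteq> j" for k
      proof (rule supp)
        have "\<alpha> k + (x + \<tau> - \<beta> i) \<in> {\<alpha> k..\<beta> k}"
          using False i \<tau> min_length_le[of k] by auto
        from disjoint[OF this that] show "\<alpha> k + (x + \<tau> - \<beta> i) \<notin> I j" by auto
      qed
      then have "(\<Sum>k\<in>UNIV. B $ i $ k * \<phi> (\<alpha> k + (x + \<tau> - \<beta> i))) =
          (\<Sum>k\<in>UNIV. if k = j then B $ i $ j * \<phi> (\<alpha> j + (x + \<tau> - \<beta> i)) else 0)"
        by (intro sum.cong) auto
      moreover have "(if i = j then \<phi> (x + \<tau>) else 0) = 0"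
        using False supp[of "x + \<tau>"] by auto
      ultimately show ?thesis
        using False by (simp add: hop_eq[OF i] w_def glue_eq[OF i] G_def algebra_simps)
    qed
  qed
  moreover have L2w: "w 0 \<in> L2 \<Omega>"
    unfolding w_def by (rule glue_shift_L2[of G G', OF G G'])
  ultimately show "\<phi> \<in> L2 \<Omega>" "ae_eq \<Omega> (U \<tau> \<phi>) (hop \<tau> \<phi>)"
  proof -
    show \<phi>: "\<phi> \<in> L2 \<Omega>" using L2_cong_on[OF L2w w0] .
    have "ae_eq \<Omega> (U \<tau> \<phi>) (U \<tau> (w 0))"
      by (rule U_cong[OF \<phi> L2w]) (simp add: ae_eq_on w0)
    also note ae_eq_sym[OF \<open>ae_eq \<Omega> (w \<tau>) (U \<tau> (w 0))\<close>]
    finally (ae_eq_trans) show "ae_eq \<Omega> (U \<tau> \<phi>) (hop \<tau> \<phi>)"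
      by (rule ae_eq_trans) (simp add: ae_eq_on \<open>\<And>x. x \<in> \<Omega> \<Longrightarrow> w \<tau> x = hop \<tau> \<phi> x\<close>)
  qed
qed

section \<open>Extending the short-time formula from C^1 functions to all of L2\<close>

context
  fixes \<tau> :: real
  assumes \<tau>: "0 \<le> \<tau>" "\<tau> < min_length"
begin

definition hop_formula :: "(real \<Rightarrow> complex) \<Rightarrow> bool" where
  "hop_formula f \<longleftrightarrow> f \<in> L2 \<Omega> \<and> ae_eq \<Omega> (U \<tau> f) (hop \<tau> f)"

lemma hop_formula_cong:
  assumes "hop_formula f" "g \<in> L2 \<Omega>" "ae_eq \<Omega> f g"
  shows "hop_formula g"
  unfolding hop_formula_def
proof
  have "ae_eq \<Omega> (U \<tau> g) (U \<tau> f)"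
    using assms by (intro U_cong ae_eq_sym[OF assms(3)]) (simp_all add: hop_formula_def)
  moreover have "ae_eq \<Omega> (U \<tau> f) (hop \<tau> f)" using assms by (simp add: hop_formula_def)
  moreover have "ae_eq \<Omega> (hop \<tau> f) (hop \<tau> g)"
    using assms \<tau> by (intro hop_cong)
  ultimately show "ae_eq \<Omega> (U \<tau> g) (hop \<tau> g)"
    by (rule ae_eq_trans[OF ae_eq_trans])
qed fact

lemma hop_formula_add:
  assumes "hop_formula f" "hop_formula g"
  shows "hop_formula (\<lambda>x. f x + g x)"
  unfolding hop_formula_def
proof
  have fg: "f \<in> L2 \<Omega>" "g \<in> L2 \<Omega>" using assms by (auto simp: hop_formula_def)
  then show "(\<lambda>x. f x + g x) \<in> L2 \<Omega>" by (rule L2_add)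
  have "hop \<tau> (\<lambda>x. f x + g x) x = hop \<tau> f x + hop \<tau> g x" if "x \<in> \<Omega>" for x
    using that by (elim \<Omega>E) (simp add: hop_eq algebra_simps sum.distrib)
  then have *: "ae_eq \<Omega> (hop \<tau> (\<lambda>x. f x + g x)) (\<lambda>x. hop \<tau> f x + hop \<tau> g x)"
    by (rule ae_eq_on)
  have **: "ae_eq \<Omega> (U \<tau> f) (hop \<tau> f)" "ae_eq \<Omega> (U \<tau> g) (hop \<tau> g)"
    using assms by (auto simp: hop_formula_def)
  show "ae_eq \<Omega> (U \<tau> (\<lambda>x. f x + g x)) (hop \<tau> (\<lambda>x. f x + g x))"
    using unitary_add[OF U_op[of \<tau>] fg] * ** unfolding ae_eq_def by eventually_elim simp
qed

lemma hop_formula_cmult: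
  assumes "hop_formula f"
  shows "hop_formula (\<lambda>x. c * f x)"
  unfolding hop_formula_def
proof
  have f: "f \<in> L2 \<Omega>" using assms by (auto simp: hop_formula_def)
  then show "(\<lambda>x. c * f x) \<in> L2 \<Omega>" by (rule L2_cmult)
  have "hop \<tau> (\<lambda>x. c * f x) x = c * hop \<tau> f x" if "x \<in> \<Omega>" for x
    using that by (elim \<Omega>E) (simp add: hop_eq sum_distrib_left mult_ac)
  then have *: "ae_eq \<Omega> (hop \<tau> (\<lambda>x. c * f x)) (\<lambda>x. c * hop \<tau> f x)"
    by (rule ae_eq_on)
  have **: "ae_eq \<Omega> (U \<tau> f) (hop \<tau> f)"
    using assms by (auto simp: hop_formula_def)
  show "ae_eq \<Omega> (U \<tau> (\<lambda>x. c * f x)) (hop \<tau> (\<lambda>x. c * f x))"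
    using unitary_cmult[OF U_op[of \<tau>] f, of c] * ** unfolding ae_eq_def by eventually_elim simp
qed

text \<open>The zero function satisfies the support condition for every interval, so the index can
  be \<open>undefined\<close>.\<close>

lemma hop_formula_zero: "hop_formula (\<lambda>x. 0)"
  unfolding hop_formula_def
  by (intro conjI hop_smooth[of "\<lambda>_. 0" "\<lambda>_. 0" undefined \<tau>] \<tau>) auto

lemma hop_formula_sum:
  assumes "\<And>k. k \<in> A \<Longrightarrow> hop_formula (f k)"
  shows "hop_formula (\<lambda>x. \<Sum>k\<in>A. f k x)"
  using assms by (induction A rule: infinite_finite_induct) (auto intro: hop_formula_zero hop_formula_add)

text \<open>Dominated convergence gives convergence in L2, the isometry carries it over to the
  images under \<open>U \<tau>\<close>, and a subsequence of these converges almost everywhere. On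
  the other side \<open>hop\<close> passes to the limit pointwise.\<close>

lemma hop_formula_LIMSEQ:
  assumes s: "\<And>n. hop_formula (s n)"
    and lim: "\<And>x. (\<lambda>n. s n x) \<longlonglongrightarrow> f x"
    and bound: "\<And>n x. x \<in> \<Omega> \<Longrightarrow> norm (s n x) \<le> norm (b x)"
    and b: "b \<in> L2 \<Omega>"
  shows "hop_formula f"
proof -
  let ?M = "lebesgue_on \<Omega>"
  have sL2: "s n \<in> L2 \<Omega>" and sU: "AE x in ?M. U \<tau> (s n) x = hop \<tau> (s n) x" for n
    using s[of n] by (auto simp: hop_formula_def ae_eq_def)
  have fm: "f \<in> borel_measurable ?M"
    by (rule borel_measurable_LIMSEQ_metric[OF L2_measurable[OF sL2] lim])
  have fb: "norm (f x) \<le> norm (b x)" if "x \<in> \<Omega>" for x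
    using lim[of x] bound[OF that] by (intro LIMSEQ_le_const2[OF tendsto_norm]) auto
  have fL2: "f \<in> L2 \<Omega>"
  proof -
    have "integrable ?M (\<lambda>x. (norm (f x))\<^sup>2)"
      by (rule Bochner_Integration.integrable_bound[OF L2_integrable[OF b]])
        (use fm fb in \<open>auto intro!: AE_I2 power_mono simp: space_restrict_space\<close>)
    with fm show ?thesis by (simp add: L2_def)
  qed
  have "(\<lambda>n. LINT x|?M. (norm (s n x - f x))\<^sup>2) \<longlonglongrightarrow> (LINT x|?M. 0)"
  proof (rule integral_dominated_convergence)
    show "integrable ?M (\<lambda>x. (norm (2 * b x))\<^sup>2)"
      by (rule L2_integrable[OF L2_cmult[OF b]])
    show "(\<lambda>x. (norm (s n x - f x))\<^sup>2) \<in> borel_measurable ?M" for n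
      using L2_measurable[OF L2_diff[OF sL2 fL2]] by simp
    show "AE x in ?M. (\<lambda>n. (norm (s n x - f x))\<^sup>2) \<longlonglongrightarrow> 0"
    proof (rule AE_I2)
      fix x
      have "(\<lambda>n. (norm (s n x - f x))\<^sup>2) \<longlonglongrightarrow> (norm (f x - f x))\<^sup>2"
        by (intro tendsto_intros lim)
      then show "(\<lambda>n. (norm (s n x - f x))\<^sup>2) \<longlonglongrightarrow> 0" by simp
    qed
    show "AE x in ?M. norm ((norm (s n x - f x))\<^sup>2) \<le> (norm (2 * b x))\<^sup>2" for n
    proof (rule AE_I2)
      fix x assume "x \<in> space ?M"
      then have "norm (s n x - f x) \<le> norm (2 * b x)"
        using bound[of x n] fb[of x] norm_triangle_ineq4[of "s n x" "f x"]
        by (simp add: space_restrict_space norm_mult)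
      then show "norm ((norm (s n x - f x))\<^sup>2) \<le> (norm (2 * b x))\<^sup>2"
        using power_mono[of "norm (s n x - f x)" "norm (2 * b x)" 2] by simp
    qed
  qed simp
  moreover have "(LINT x|?M. (norm (U \<tau> (s n) x - U \<tau> f x))\<^sup>2) = (LINT x|?M. (norm (s n x - f x))\<^sup>2)" for n
    using unitary_norm_diff[OF U_op sL2 fL2, of \<tau> n] by (simp add: L2_norm_def)
  ultimately have "(\<lambda>n. LINT x|?M. norm ((norm (U \<tau> (s n) x - U \<tau> f x))\<^sup>2)) \<longlonglongrightarrow> 0"
    by simp
  then obtain r where r: "strict_mono r"
      "AE x in ?M. (\<lambda>n. (norm (U \<tau> (s (r n)) x - U \<tau> f x))\<^sup>2) \<longlonglongrightarrow> 0"
    using tendsto_L1_AE_subseq[of ?M "\<lambda>n x. (norm (U \<tau> (s n) x - U \<tau> f x))\<^sup>2"]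
      L2_integrable[OF L2_diff[OF U_L2[OF sL2] U_L2[OF fL2]]] by auto
  have "AE x in ?M. \<forall>n. U \<tau> (s n) x = hop \<tau> (s n) x"
    using sU by (simp add: AE_all_countable)
  with r(2) have "AE x in ?M. U \<tau> f x = hop \<tau> f x"
  proof eventually_elim
    case (elim x)
    \<comment> \<open>Each value of \<open>hop\<close> is a finite combination of values at other
      points, so convergence of \<open>s n\<close> at every point passes directly to
      \<open>hop\<close>.\<close>
    have "(\<lambda>n. hop \<tau> (s n) x) \<longlonglongrightarrow> hop \<tau> f x"
      unfolding hop_def glue_def
      by (intro tendsto_sum tendsto_mult tendsto_const) (auto intro!: tendsto_intros lim)
    then have "(\<lambda>n. U \<tau> (s (r n)) x) \<longlonglongrightarrow> hop \<tau> f x"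
      using elim(2) LIMSEQ_subseq_LIMSEQ[OF _ r(1)] by (auto simp: o_def)
    moreover have "(\<lambda>n. sqrt ((norm (U \<tau> (s (r n)) x - U \<tau> f x))\<^sup>2)) \<longlonglongrightarrow> sqrt 0"
      by (intro tendsto_intros elim(1))
    then have "(\<lambda>n. U \<tau> (s (r n)) x) \<longlonglongrightarrow> U \<tau> f x"
      by (simp add: tendsto_norm_zero_iff Lim_null[of _ "U \<tau> f x"])
    ultimately show ?case by (rule LIMSEQ_unique[rotated])
  qed
  with fL2 show ?thesis by (simp add: hop_formula_def ae_eq_def)
qed

lemma one_L2: "(\<lambda>x. 1) \<in> L2 \<Omega>"
  by (rule L2_bounded(1)[OF _ lmeasurable_\<Omega>, of _ 1]) auto

text \<open>The bumps with \<open>e\<close> tending to \<open>0\<close> are C^1, supported in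
  \<open>I j\<close>, bounded by \<open>1\<close>, and converge pointwise to the indicator.\<close>

lemma hop_formula_interval:
  assumes "a < b" "{a<..<b} \<subseteq> I j"
  shows "hop_formula (indicator {a<..<b})"
proof (rule hop_formula_LIMSEQ[where b = "\<lambda>_. 1"])
  fix k
  define e where "e = inverse (real (Suc k))"
  have e: "e > 0" by (simp add: e_def)
  obtain u' where u': "\<And>x. (bump a b e has_real_derivative u' x) (at x)" "continuous_on UNIV u'"
    using bump_derivative[OF e, of a b] by blast
  have d: "((\<lambda>x. complex_of_real (bump a b e x)) has_vector_derivative complex_of_real (u' x)) (at x)" for x
    using has_vector_derivative_of_real[OF u'(1)] .
  have c: "continuous_on UNIV (\<lambda>x. complex_of_real (u' x))"
    by (intro continuous_intros u')
  have z: "complex_of_real (bump a b e x) = 0" if "x \<notin> I j" for x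
  proof -
    have "x \<notin> {a<..<b}" using that assms by blast
    then show ?thesis using assms by (simp add: bump_eq_0)
  qed
  show "hop_formula (\<lambda>x. complex_of_real (bump a b (inverse (real (Suc k))) x))"
    unfolding hop_formula_def e_def[symmetric] using hop_smooth[OF d c z \<tau>] by simp
next
  fix x
  have "(\<lambda>k. complex_of_real (bump a b (inverse (real (Suc k))) x)) \<longlonglongrightarrow> complex_of_real (indicator {a<..<b} x)"
    by (intro tendsto_of_real bump_LIMSEQ assms)
  then show "(\<lambda>k. complex_of_real (bump a b (inverse (real (Suc k))) x)) \<longlonglongrightarrow> indicator {a<..<b} x"
    by (cases "x \<in> {a<..<b}") simp_all
next
  fix n x
  show "norm (complex_of_real (bump a b (inverse (real (Suc n))) x)) \<le> norm (1::complex)"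
    using bump_bounds[of "inverse (real (Suc n))" a b x] by simp
qed (rule one_L2)

text \<open>Dynkin's theorem for the intersection-stable generator of open intervals. Intersecting
  with \<open>I j\<close> keeps the generating functions inside one interval; complements are then
  taken relative to \<open>I j\<close>, whose own indicator is already covered.\<close>

lemma hop_formula_borel:
  assumes "A \<in> sets borel"
  shows "hop_formula (indicator (A \<inter> I j))"
proof -
  have gen: "(borel :: real measure) = sigma UNIV (range (\<lambda>(a, b). {a<..<b}))"
    using borel_eq_box[where 'a = real] by (simp add: box_real)
  have A: "A \<in> sigma_sets UNIV (range (\<lambda>(a, b). {a<..<b}))"
    using assms unfolding gen by simp
  have stable: "Int_stable (range (\<lambda>(a::real, b). {a<..<b}))"
  proof (rule Int_stableI)
    fix X Y :: "real set" assume "X \<in> range (\<lambda>(a, b). {a<..<b})" "Y \<in> range (\<lambda>(a, b). {a<..<b})"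
    then obtain a b c d where "X = {a<..<b}" "Y = {c<..<d}" by auto
    then have "X \<inter> Y = {max a c<..<min b d}" by simp
    then show "X \<inter> Y \<in> range (\<lambda>(a, b). {a<..<b})"
      by (intro image_eqI[of _ _ "(max a c, min b d)"]) simp_all
  qed
  show ?thesis
  proof (rule sigma_sets_induct_disjoint[OF stable _ A, where P = "\<lambda>A. hop_formula (indicator (A \<inter> I j))"])
    show "hop_formula (indicator (X \<inter> I j))" if "X \<in> range (\<lambda>(a, b). {a<..<b})" for X
    proof -
      from that obtain a b where "X = {a<..<b}" by auto
      then have X: "X \<inter> I j = {max a (\<alpha> j)<..<min b (\<beta> j)}" by simp
      show ?thesis
      proof (cases "max a (\<alpha> j) < min b (\<beta> j)")
        case True
        then show ?thesis unfolding X by (rule hop_formula_interval[where j = j]) (simp add: subset_iff)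
      next
        case False
        then have "X \<inter> I j = {}" unfolding X by (simp only: greaterThanLessThan_empty not_less)
        then show ?thesis using hop_formula_zero by (simp add: indicator_def[abs_def])
      qed
    qed
    show "hop_formula (indicator ({} \<inter> I j))"
      using hop_formula_zero by (simp add: indicator_def[abs_def])
  next
    fix X assume "hop_formula (indicator (X \<inter> I j))"
    moreover have "hop_formula (indicator (I j))"
      by (rule hop_formula_interval[where j = j]) (simp_all add: endpoint_less)
    ultimately have "hop_formula (\<lambda>x. indicator (I j) x + (- 1) * indicator (X \<inter> I j) x)"
      by (intro hop_formula_add hop_formula_cmult)
    moreover have "(\<lambda>x. indicator (I j) x + (- 1) * indicator (X \<inter> I j) x) =
        (indicator ((UNIV - X) \<inter> I j) :: real \<Rightarrow> complex)"
      by (auto simp: indicator_def)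
    ultimately show "hop_formula (indicator ((UNIV - X) \<inter> I j))" by simp
  next
    fix X :: "nat \<Rightarrow> real set"
    assume X: "disjoint_family X" "\<And>i. hop_formula (indicator (X i \<inter> I j))"
    have sum: "(\<Sum>k<n. indicator (X k \<inter> I j) x) = (indicator (\<Union>k<n. X k \<inter> I j) x :: complex)" for n x
      using X(1) by (intro indicator_UN_disjoint[symmetric]) (auto simp: disjoint_family_on_def)
    show "hop_formula (indicator ((\<Union>i. X i) \<inter> I j))"
    proof (rule hop_formula_LIMSEQ[where b = "\<lambda>_. 1"])
      show "hop_formula (\<lambda>x. \<Sum>k<n. indicator (X k \<inter> I j) x)" for n
        by (intro hop_formula_sum X)
      show "(\<lambda>n. \<Sum>k<n. indicator (X k \<inter> I j) x) \<longlonglongrightarrow> (indicator ((\<Union>i. X i) \<inter> I j) x :: complex)" for x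
      proof -
        have "(\<Union>i. X i) \<inter> I j = (\<Union>i. X i \<inter> I j)" by blast
        then show ?thesis unfolding sum by (simp only: LIMSEQ_indicator_UN)
      qed
      show "norm (\<Sum>k<n. indicator (X k \<inter> I j) x :: complex) \<le> norm (1::complex)" for n x
        unfolding sum by (simp add: indicator_def)
    qed (rule one_L2)
  qed simp
qed

text \<open>A Lebesgue set differs from a Borel set by a null set, and the formula respects
  almost-everywhere equality; the pieces in the separate intervals are summed.\<close>

lemma hop_formula_lebesgue:
  assumes "A \<in> sets lebesgue"
  shows "hop_formula (indicator A)"
proof -
  from assms obtain S N N' where A: "A = S \<union> N" "N \<subseteq> N'" "N' \<in> null_sets lborel" "S \<in> sets lborel"
    by (rule sets_completionE)
  have "hop_formula (\<lambda>x. \<Sum>j\<in>UNIV. indicator (S \<inter> I j) x)"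
    using A by (intro hop_formula_sum hop_formula_borel) auto
  then show ?thesis
  proof (rule hop_formula_cong)
    show "indicator A \<in> L2 \<Omega>"
      using assms by (intro L2_bounded(1)[OF _ lmeasurable_\<Omega>, of _ 1])
        (auto intro!: measurable_restrict_space1 simp: indicator_def)
    have "AE x in lebesgue. x \<notin> N'"
      using A(3) by (intro AE_not_in null_sets_completionI)
    then have "AE x in lebesgue. x \<in> \<Omega> \<longrightarrow> (\<Sum>j\<in>UNIV. indicator (S \<inter> I j) x) = (indicator A x :: complex)"
    proof eventually_elim
      case (elim x)
      show ?case
      proof
        assume "x \<in> \<Omega>"
        then obtain i where i: "x \<in> I i" by (rule \<Omega>E)
        have "(\<Sum>j\<in>UNIV. indicator (S \<inter> I j) x) = (\<Sum>j\<in>UNIV. if j = i then indicator S x else (0::complex))"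
          using i index_unique by (intro sum.cong) (auto simp: indicator_def)
        also have "\<dots> = indicator A x"
          using elim A by (auto simp: indicator_def)
        finally show "(\<Sum>j\<in>UNIV. indicator (S \<inter> I j) x) = (indicator A x :: complex)" .
      qed
    qed
    then show "ae_eq \<Omega> (\<lambda>x. \<Sum>j\<in>UNIV. indicator (S \<inter> I j) x) (indicator A)"
      by (simp add: ae_eq_def AE_\<Omega>)
  qed
qed

lemma hop_formula_simple:
  fixes F :: "real \<Rightarrow> complex"
  assumes "simple_function lebesgue F"
  shows "hop_formula F"
proof -
  have fin: "finite (range F)" and meas: "y \<in> range F \<Longrightarrow> F -` {y} \<in> sets lebesgue" for y
    using assms by (auto simp: simple_function_def vimage_def)
  have "F = (\<lambda>x. \<Sum>y\<in>range F. y * indicator (F -` {y}) x)"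
  proof
    fix x
    have "(\<Sum>y\<in>range F. y * indicator (F -` {y}) x) = (\<Sum>y\<in>range F. if y = F x then y else 0)"
      by (intro sum.cong) (auto simp: indicator_def)
    then show "F x = (\<Sum>y\<in>range F. y * indicator (F -` {y}) x)"
      using fin by simp
  qed
  moreover have "hop_formula (\<lambda>x. \<Sum>y\<in>range F. y * indicator (F -` {y}) x)"
    by (intro hop_formula_sum hop_formula_cmult hop_formula_lebesgue meas)
  ultimately show ?thesis by simp
qed

end

lemma small_time:
  assumes \<tau>: "0 \<le> \<tau>" "\<tau> < min_length" and f: "f \<in> L2 \<Omega>"
  shows "ae_eq \<Omega> (U \<tau> f) (hop \<tau> f)"
proof -
  \<comment> \<open>Cutting off outside \<Omega> yields a function measurable on the whole line, to
    which approximation by simple functions applies.\<close>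
  define g where "g x = indicator \<Omega> x *\<^sub>R f x" for x
  have gf: "g x = f x" if "x \<in> \<Omega>" for x using that by (simp add: g_def)
  have gL2: "g \<in> L2 \<Omega>" by (rule L2_cong_on[OF f]) (simp add: gf)
  have "g \<in> borel_measurable lebesgue"
    using L2_measurable[OF f] sets_\<Omega> unfolding g_def
    by (subst (asm) borel_measurable_restrict_space_iff) auto
  \<comment> \<open>Approximating relative to the base point \<open>0\<close> supplies the
    domination by \<open>2 * norm (g x)\<close>.\<close>
  from borel_measurable_implies_sequence_metric[OF this, of 0] obtain F
    where F: "\<And>i. simple_function lebesgue (F i)" "\<And>x. (\<lambda>i. F i x) \<longlonglongrightarrow> g x"
      "\<And>i x. norm (F i x) \<le> 2 * norm (g x)"
    by auto
  have "hop_formula \<tau> g"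
    by (rule hop_formula_LIMSEQ[OF \<tau>, of F g "\<lambda>x. 2 * g x"])
      (use F hop_formula_simple[OF \<tau>] L2_cmult[OF gL2] in \<open>auto simp: norm_mult\<close>)
  then have "hop_formula \<tau> f"
    by (rule hop_formula_cong[OF \<tau>]) (auto intro: f ae_eq_on gf)
  then show ?thesis by (simp add: hop_formula_def[OF \<tau>])
qed

end

section \<open>Sums over paths\<close>

lemma path_weight_Cons: "w \<noteq> [] \<Longrightarrow> path_weight B (i # w) = B $ i $ (hd w) * path_weight B w"
proof -
  assume "w \<noteq> []"
  then obtain m where m: "length w = Suc m" by (cases w) auto
  have "path_weight B (i # w) = (\<Prod>k<Suc m. B $ ((i # w) ! k) $ ((i # w) ! Suc k))"
    by (simp add: path_weight_def m)
  also have "\<dots> = B $ i $ (hd w) * (\<Prod>k<m. B $ (w ! k) $ (w ! Suc k))"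
    using \<open>w \<noteq> []\<close> by (subst prod.lessThan_Suc_shift) (simp add: hd_conv_nth)
  finally show ?thesis by (simp add: path_weight_def m)
qed

text \<open>The set where the functions differ is open and negligible, hence empty.\<close>

lemma continuous_ae_eq_imp_eq:
  assumes "open S" "continuous_on S g" "continuous_on S h" "ae_eq S g h" "x \<in> S"
  shows "g x = h x"
proof -
  let ?D = "{x \<in> S. g x \<noteq> h x}"
  have "open ((\<lambda>x. g x - h x) -` (- {0}) \<inter> S)"
    using assms by (intro continuous_on_open_vimage[THEN iffD1, rule_format] continuous_intros) auto
  moreover have "(\<lambda>x. g x - h x) -` (- {0}) \<inter> S = ?D" by auto
  ultimately have "open ?D" by simp
  moreover have "negligible ?D"
  proof -
    have "AE x in lebesgue. x \<in> S \<longrightarrow> g x = h x"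
      using assms(1,4) unfolding ae_eq_def by (subst (asm) AE_restrict_space_iff) auto
    then obtain N where N: "{x. \<not> (x \<in> S \<longrightarrow> g x = h x)} \<subseteq> N" "negligible N"
      by (auto simp: eventually_ae_filter negligible_iff_null_sets)
    then show ?thesis by (intro negligible_subset[OF N(2)]) auto
  qed
  ultimately have "?D = {}" using open_not_negligible by blast
  then show ?thesis using assms(5) by auto
qed

lemma cont_value_eqI:
  assumes "open S" "continuous_on S h" "ae_eq S h f" "x \<in> S"
  shows "cont_value S f x = h x"
  unfolding cont_value_def
proof (rule the_equality)
  show "\<exists>h'. continuous_on S h' \<and> ae_eq S h' f \<and> h x = h' x"
    using assms by blast
next
  fix y assume "\<exists>h'. continuous_on S h' \<and> ae_eq S h' f \<and> y = h' x"
  then obtain h' where "continuous_on S h'" "ae_eq S h' f" "y = h' x" by blast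
  then show "y = h x"
    using continuous_ae_eq_imp_eq[OF assms(1) _ assms(2) ae_eq_trans[OF _ ae_eq_sym[OF assms(3)]] assms(4)]
    by simp
qed

text \<open>This is the case of a single interval, \<open>m = 1\<close>; convexity places the
  segment between the two points inside \<open>S\<close>.\<close>

lemma abs_continuous_imp_uniformly_continuous:
  assumes "abs_continuous_on S f" "convex S"
  shows "uniformly_continuous_on S f"
  unfolding uniformly_continuous_on_def
proof (intro allI impI)
  fix e :: real assume "e > 0"
  with assms obtain d where d: "d > 0"
    "\<And>(m::nat) a b. (\<forall>k<m. a k \<le> b k \<and> {a k..b k} \<subseteq> S) \<and>
        (\<forall>j<m. \<forall>k<m. j \<noteq> k \<longrightarrow> {a j<..<b j} \<inter> {a k<..<b k} = {}) \<and>
        (\<Sum>k<m. b k - a k) < d \<Longrightarrow> (\<Sum>k<m. norm (f (b k) - f (a k))) < e"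
    unfolding abs_continuous_on_def by blast
  have le: "norm (f y - f x) < e" if "x \<in> S" "y \<in> S" "x \<le> y" "y - x < d" for x y
  proof -
    have "{x..y} \<subseteq> S"
      using closed_segment_subset[OF that(1,2) assms(2)] that(3) by (simp add: closed_segment_eq_real_ivl)
    then show ?thesis
      using d(2)[of 1 "\<lambda>_. x" "\<lambda>_. y"] that by simp
  qed
  show "\<exists>d>0. \<forall>x\<in>S. \<forall>x'\<in>S. dist x' x < d \<longrightarrow> dist (f x') (f x) < e"
  proof (intro exI[of _ d] conjI ballI impI)
    fix x x' assume "x \<in> S" "x' \<in> S" "dist x' x < d"
    then show "dist (f x') (f x) < e"
      using le[of x x'] le[of x' x] by (cases "x \<le> x'") (auto simp: dist_norm norm_minus_commute)
  qed (rule d)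
qed

section \<open>Extending a function along the boundary conditions\<close>

context boundary_unitary_group
begin

lemma AE_in_\<Omega>: "AE x in lebesgue_on \<Omega>. x \<in> \<Omega>"
  by (rule AE_I2) (simp add: space_restrict_space)

abbreviation path_length :: "'n list \<Rightarrow> real" where
  "path_length w \<equiv> (\<Sum>k\<leftarrow>w. \<beta> k - \<alpha> k)"

text \<open>The admissible paths for \<open>x\<close> and \<open>t\<close> and their end points depend only on \<open>y = x + t\<close> and on the
  interval \<open>i\<close> of \<open>x\<close>, as does the sum in the theorem. It is the value at \<open>y\<close> of the extension of
  \<open>f\<close> from the \<open>i\<close>-th interval to \<open>[\<alpha>\<^sub>i, \<infinity>)\<close> along the boundary conditions.\<close>

definition paths_from :: "'n \<Rightarrow> real \<Rightarrow> 'n list set" where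
  "paths_from i y = {w. w \<noteq> [] \<and> hd w = i \<and> \<alpha> i + path_length (butlast w) \<le> y \<and>
     y < \<alpha> i + path_length (butlast w) + (\<beta> (last w) - \<alpha> (last w))}"

definition continuation :: "(real \<Rightarrow> complex) \<Rightarrow> 'n \<Rightarrow> real \<Rightarrow> complex" where
  "continuation f i y = (\<Sum>w\<in>paths_from i y. path_weight B w *
     eval_ext \<Omega> f (\<alpha> (last w) + (y - \<alpha> i - path_length (butlast w))))"

lemma path_length_nonneg: "path_length w \<ge> 0"
  using endpoint_less by (intro sum_list_nonneg) (auto simp: less_imp_le)

lemma paths_from_short:
  assumes "\<alpha> i \<le> y" "y < \<beta> i"
  shows "paths_from i y = {[i]}"
proof
  show "paths_from i y \<subseteq> {[i]}"
  proof
    fix w assume w: "w \<in> paths_from i y"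
    then obtain v where v: "w = i # v" by (cases w) (auto simp: paths_from_def)
    have "v = []"
    proof (rule ccontr)
      assume "v \<noteq> []"
      then show False
        using w assms path_length_nonneg[of "butlast v"] by (simp add: v paths_from_def)
    qed
    then show "w \<in> {[i]}" by (simp add: v)
  qed
qed (use assms in \<open>simp add: paths_from_def\<close>)

text \<open>Dropping the first index leaves a path that starts at the left end point of its first
  interval \<open>k\<close> and still has the excess \<open>y - \<beta> i\<close> to cover.\<close>

lemma paths_from_long:
  assumes "\<beta> i \<le> y"
  shows "paths_from i y = (\<Union>k. Cons i ` paths_from k (\<alpha> k + (y - \<beta> i)))"
proof (intro equalityI subsetI)
  fix w assume w: "w \<in> paths_from i y"
  then obtain v where v: "w = i # v" by (cases w) (auto simp: paths_from_def)
  have "v \<noteq> []" using w assms by (auto simp: v paths_from_def)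
  then have "v \<in> paths_from (hd v) (\<alpha> (hd v) + (y - \<beta> i))"
    using w by (simp add: v paths_from_def)
  then show "w \<in> (\<Union>k. Cons i ` paths_from k (\<alpha> k + (y - \<beta> i)))"
    unfolding v by blast
qed (auto simp: paths_from_def)

text \<open>Crossing an interval uses up at least \<open>min_length\<close>, so induction on the
  number of such units in \<open>y - \<alpha> i\<close> applies; there are finitely many choices for
  the next index.\<close>

lemma finite_paths_from: "finite (paths_from i y)"
proof -
  obtain N :: nat where "y - \<alpha> i < real N * min_length"
    using ex_less_of_nat_mult[OF min_length_pos] by blast
  then show ?thesis
  proof (induction N arbitrary: i y)
    case 0
    then have "paths_from i y = {}"
    proof -
      have "\<not> \<alpha> i + path_length (butlast w) \<le> y" for w
        using 0 path_length_nonneg[of "butlast w"] by simp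
      then show ?thesis by (auto simp: paths_from_def)
    qed
    then show ?case by simp
  next
    case (Suc N)
    show ?case
    proof (cases "y < \<beta> i")
      case True
      have "paths_from i y \<subseteq> {[i]}"
      proof (cases "\<alpha> i \<le> y")
        case True
        then show ?thesis using paths_from_short[OF _ \<open>y < \<beta> i\<close>] by simp
      next
        case False
        have "\<not> \<alpha> i + path_length (butlast w) \<le> y" for w
          using False path_length_nonneg[of "butlast w"] by simp
        then show ?thesis by (auto simp: paths_from_def)
      qed
      then show ?thesis by (rule finite_subset) simp
    next
      case False
      have "y - \<beta> i < real N * min_length"
        using Suc.prems min_length_le[of i] by (simp add: algebra_simps)
      then show ?thesis
        using False Suc.IH[of "\<alpha> _ + (y - \<beta> i)"] by (simp add: paths_from_long)
    qed
  qed
qed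

lemma continuation_short:
  "\<alpha> i \<le> y \<Longrightarrow> y < \<beta> i \<Longrightarrow> continuation f i y = eval_ext \<Omega> f y"
  by (simp add: continuation_def paths_from_short path_weight_def)

text \<open>Sorting the paths by their second index \<open>k\<close> splits the sum into disjoint
  parts, and the first factor of each weight is \<open>B $ i $ k\<close>. This is the recursion that
  matches the crossing branch of \<open>hop\<close>.\<close>

lemma continuation_long:
  assumes "\<beta> i \<le> y"
  shows "continuation f i y = (\<Sum>k\<in>UNIV. B $ i $ k * continuation f k (\<alpha> k + (y - \<beta> i)))"
proof -
  let ?y = "\<lambda>k. \<alpha> k + (y - \<beta> i)"
  let ?F = "\<lambda>w. path_weight B w * eval_ext \<Omega> f (\<alpha> (last w) + (y - \<alpha> i - path_length (butlast w)))"
  have "continuation f i y = (\<Sum>k\<in>UNIV. \<Sum>w\<in>Cons i ` paths_from k (?y k). ?F w)"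
    unfolding continuation_def paths_from_long[OF assms]
    by (rule sum.UNION_disjoint) (auto simp: finite_paths_from, auto simp: paths_from_def)
  also have "\<dots> = (\<Sum>k\<in>UNIV. B $ i $ k * continuation f k (?y k))"
  proof (rule sum.cong[OF refl])
    fix k
    have "(\<Sum>w\<in>Cons i ` paths_from k (?y k). ?F w) = (\<Sum>w\<in>paths_from k (?y k). ?F (i # w))"
      by (subst sum.reindex) auto
    also have "\<dots> = (\<Sum>w\<in>paths_from k (?y k). B $ i $ k * (path_weight B w *
        eval_ext \<Omega> f (\<alpha> (last w) + (?y k - \<alpha> k - path_length (butlast w)))))"
    proof (rule sum.cong[OF refl])
      fix w assume w: "w \<in> paths_from k (?y k)"
      then have ne: "w \<noteq> []" and hd: "hd w = k" by (auto simp: paths_from_def)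
      have e: "y - \<alpha> i - path_length (butlast (i # w)) = ?y k - \<alpha> k - path_length (butlast w)"
        using ne by simp
      show "?F (i # w) = B $ i $ k * (path_weight B w *
          eval_ext \<Omega> f (\<alpha> (last w) + (?y k - \<alpha> k - path_length (butlast w))))"
        unfolding e path_weight_Cons[OF ne] hd using ne by (simp only: last.simps if_False mult.assoc)
    qed
    also have "\<dots> = B $ i $ k * continuation f k (?y k)"
      unfolding continuation_def by (rule sum_distrib_left[symmetric])
    finally show "(\<Sum>w\<in>Cons i ` paths_from k (?y k). ?F w) = B $ i $ k * continuation f k (?y k)" .
  qed
  finally show ?thesis .
qed

lemma path_sum_eq_continuation:
  assumes x: "x \<in> I i" and t: "t \<ge> \<beta> i - x"
  shows "(\<Sum>w\<in>paths \<alpha> \<beta> x t. path_weight B w * eval_ext \<Omega> f (\<alpha> (last w) + remainder \<alpha> \<beta> x t w)) =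
    continuation f i (x + t)"
proof -
  \<comment> \<open>Lengths are now measured from \<alpha> i instead of \<open>x\<close>. For the
    one-element path the identity fails: \<open>travelled\<close> already counts the rest of the
    first interval, while \<open>butlast\<close> is empty.\<close>
  have trav: "travelled \<alpha> \<beta> x (i # v) = \<alpha> i + path_length (butlast (i # v)) - x" if "v \<noteq> []" for v
    using that by (simp add: travelled_def)
  have "paths \<alpha> \<beta> x t = paths_from i (x + t)"
  proof (intro equalityI subsetI)
    fix w assume "w \<in> paths \<alpha> \<beta> x t"
    then have w: "admissible_path \<alpha> \<beta> x t w" by (simp add: paths_def)
    then have "hd w = i" using x index_unique unfolding admissible_path_def by blast
    with w obtain v where v: "w = i # v" by (cases w) (auto simp: admissible_path_def)
    have "v \<noteq> []" using w t by (auto simp: v admissible_path_def)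
    then show "w \<in> paths_from i (x + t)"
      using w t unfolding v admissible_path_def paths_from_def trav[OF \<open>v \<noteq> []\<close>]
      by (simp only: list.sel last.simps if_False mem_Collect_eq) auto
  next
    fix w assume w: "w \<in> paths_from i (x + t)"
    then obtain v where v: "w = i # v" by (cases w) (auto simp: paths_from_def)
    have "v \<noteq> []" using w t by (auto simp: v paths_from_def)
    then show "w \<in> paths \<alpha> \<beta> x t"
      using w t x unfolding paths_def v admissible_path_def paths_from_def trav[OF \<open>v \<noteq> []\<close>]
      by (cases v) (auto simp: trav)
  qed
  moreover have "remainder \<alpha> \<beta> x t w = x + t - \<alpha> i - path_length (butlast w)" if w: "w \<in> paths_from i (x + t)" for w
  proof -
    obtain v where v: "w = i # v" using w by (cases w) (auto simp: paths_from_def)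
    have "v \<noteq> []" using w t by (auto simp: v paths_from_def)
    from trav[OF this] show ?thesis unfolding v remainder_def by linarith
  qed
  ultimately show ?thesis
    unfolding continuation_def by (intro sum.cong) auto
qed

text \<open>\<open>t\<close> is cut into \<open>N\<close> equal steps shorter than
  \<open>min_length\<close>. Each step is one application of \<open>hop\<close>, by the group law
  and \<open>small_time\<close>, and \<open>continuation\<close> obeys the same recursion.\<close>

lemma U_eq_continuation:
  assumes f: "f \<in> L2 \<Omega>" and t: "t \<ge> 0"
  shows "AE x in lebesgue_on \<Omega>. \<forall>i. x \<in> I i \<longrightarrow> U t f x = continuation f i (x + t)"
proof -
  obtain N :: nat where N: "t < real N * min_length"
    using ex_less_of_nat_mult[OF min_length_pos] by blast
  then have "N > 0" using t by (cases N) auto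
  define \<tau> where "\<tau> = t / real N"
  have \<tau>: "0 \<le> \<tau>" "\<tau> < min_length"
    using t N \<open>N > 0\<close> by (auto simp: \<tau>_def field_simps)
  have "AE x in lebesgue_on \<Omega>. \<forall>i. x \<in> I i \<longrightarrow> U (real n * \<tau>) f x = continuation f i (x + real n * \<tau>)" for n
  proof (induction n)
    case 0
    have "ae_eq \<Omega> (U 0 f) f"
      using U_group f by (simp add: unitary_group_def)
    then show ?case
      unfolding ae_eq_def
    proof eventually_elim
      case (elim x)
      then show ?case using I_subset[of x] by (auto simp: continuation_short eval_ext_def)
    qed
  next
    case (Suc n)
    let ?g = "U (real n * \<tau>) f"
    have g: "?g \<in> L2 \<Omega>" by (rule U_L2[OF f])
    have "ae_eq \<Omega> (U (real (Suc n) * \<tau>) f) (U \<tau> ?g)"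
    proof -
      have "real (Suc n) * \<tau> = \<tau> + real n * \<tau>" by (simp add: algebra_simps)
      then show ?thesis using U_group f unfolding unitary_group_def by metis
    qed
    moreover have "ae_eq \<Omega> (U \<tau> ?g) (hop \<tau> ?g)"
      by (rule small_time[OF \<tau> g])
    ultimately have "AE x in lebesgue_on \<Omega>. U (real (Suc n) * \<tau>) f x = hop \<tau> ?g x"
      using ae_eq_trans unfolding ae_eq_def by blast
    \<comment> \<open>The induction hypothesis is used at the landing points of \<open>hop\<close>,
      possibly in other intervals; hence it is stated for every \<open>i\<close> and must hold at
      translates of almost every \<open>x\<close>.\<close>
    then show ?case
      using AE_hop_points[OF Suc.IH \<tau>]
    proof eventually_elim
      case (elim x)
      show ?case
      proof (intro allI impI)
        fix i assume i: "x \<in> I i"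
        have arg: "x + real (Suc n) * \<tau> = (x + \<tau>) + real n * \<tau>" by (simp add: algebra_simps)
        show "U (real (Suc n) * \<tau>) f x = continuation f i (x + real (Suc n) * \<tau>)"
        proof (cases "x + \<tau> < \<beta> i")
          case True
          then have "x + \<tau> \<in> I i" using i \<tau> by auto
          then show ?thesis
            using elim(1) elim(2)[rule_format, OF i] True unfolding hop_eq[OF i] arg by auto
        next
          case False
          \<comment> \<open>Once the first step has crossed \<beta> i, so has the whole journey, and
            the recursion for \<open>continuation\<close> can be unfolded.\<close>
          then have ge: "\<beta> i \<le> x + \<tau> + real n * \<tau>"
            using \<tau> mult_nonneg_nonneg[of "real n" \<tau>] by linarith
          have "continuation f i (x + \<tau> + real n * \<tau>) =
              (\<Sum>j\<in>UNIV. B $ i $ j * continuation f j (\<alpha> j + (x + \<tau> - \<beta> i) + real n * \<tau>))"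
            unfolding continuation_long[OF ge] by (simp add: algebra_simps)
          also have "\<dots> = (\<Sum>j\<in>UNIV. B $ i $ j * ?g (\<alpha> j + (x + \<tau> - \<beta> i)))"
          proof (rule sum.cong[OF refl])
            fix j
            let ?y = "\<alpha> j + (x + \<tau> - \<beta> i)"
            have "?y \<in> I j \<and> (\<forall>k. ?y \<in> I k \<longrightarrow> ?g ?y = continuation f k (?y + real n * \<tau>))"
              using elim(2)[rule_format, OF i] unfolding if_not_P[OF False] by (rule spec)
            then show "B $ i $ j * continuation f j (?y + real n * \<tau>) = B $ i $ j * ?g ?y"
              by metis
          qed
          finally show ?thesis
            using elim(1) False unfolding hop_eq[OF i] arg by simp
        qed
      qed
    qed
  qed
  from this[of N] show ?thesis
    using \<open>N > 0\<close> by (simp add: \<tau>_def)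
qed

text \<open>On the closed interval from \<alpha> i to \<beta> i the function is \<open>f\<close>
  with its one-sided limits; the recursion then carries continuity to the right in steps of
  \<open>min_length\<close>.\<close>

lemma continuation_continuous:
  assumes f: "f \<in> D_dom \<alpha> \<beta> B"
  shows "continuous_on {\<alpha> i..} (continuation f i)"
proof -
  \<comment> \<open>Uniform continuity guarantees that the one-sided limits exist, so that each
    \<open>Lim\<close> below is a genuine limit.\<close>
  have uc: "uniformly_continuous_on (I i) f" for i
    using f by (intro abs_continuous_imp_uniformly_continuous) (auto simp: D_dom_def D_max_def)
  have limr: "(f \<longlongrightarrow> Lim (at_right (\<alpha> i)) f) (at_right (\<alpha> i))" for i
  proof -
    have "\<alpha> i \<in> closure (I i)" using endpoint_less[of i] by simp
    then obtain l where "(f \<longlongrightarrow> l) (at (\<alpha> i) within I i)"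
      using uniformly_continuous_on_extension_at_closure[OF uc] by blast
    moreover have "at (\<alpha> i) within I i = at_right (\<alpha> i)"
      by (rule at_within_nhd[of _ "{..<\<beta> i}"]) (use endpoint_less[of i] in auto)
    ultimately have "(f \<longlongrightarrow> l) (at_right (\<alpha> i))" by simp
    then show ?thesis by (simp add: tendsto_Lim)
  qed
  have liml: "(f \<longlongrightarrow> Lim (at_left (\<beta> i)) f) (at_left (\<beta> i))" for i
  proof -
    have "\<beta> i \<in> closure (I i)" using endpoint_less[of i] by simp
    then obtain l where "(f \<longlongrightarrow> l) (at (\<beta> i) within I i)"
      using uniformly_continuous_on_extension_at_closure[OF uc] by blast
    moreover have "at (\<beta> i) within I i = at_left (\<beta> i)"
      by (rule at_within_nhd[of _ "{\<alpha> i<..}"]) (use endpoint_less[of i] in auto)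
    ultimately have "(f \<longlongrightarrow> l) (at_left (\<beta> i))" by simp
    then show ?thesis by (simp add: tendsto_Lim)
  qed
  have inner: "continuation f i x = f x" if "x \<in> I i" for i x
    using that I_subset[OF that] by (simp add: continuation_short eval_ext_def)
  have left: "continuation f i (\<alpha> i) = Lim (at_right (\<alpha> i)) f" for i
  proof -
    have "\<alpha> i \<notin> \<Omega>"
    proof
      assume "\<alpha> i \<in> \<Omega>"
      then obtain j where "\<alpha> i \<in> I j" by (rule \<Omega>E)
      then show False using disjoint[of "\<alpha> i" i j] endpoint_less[of i] by (cases "i = j") auto
    qed
    then show ?thesis by (simp add: continuation_short endpoint_less eval_ext_def)
  qed
  \<comment> \<open>The recursion at \<open>y = \<beta> i\<close> evaluates to the left-hand side of
    the boundary condition in \<open>D_dom\<close>; this is where the extension joins without a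
    jump.\<close>
  have right: "continuation f i (\<beta> i) = Lim (at_left (\<beta> i)) f" for i
    using f by (simp add: continuation_long left D_dom_def vec_eq_iff matrix_vector_mult_def)
  have base: "continuous_on {\<alpha> i..\<beta> i} (continuation f i)" for i
  proof (rule continuous_on_IccI)
    have "\<forall>\<^sub>F x in at_right (\<alpha> i). x \<in> I i"
      using eventually_at_right_real[OF endpoint_less[of i]] by simp
    then show "(continuation f i \<longlongrightarrow> continuation f i (\<alpha> i)) (at_right (\<alpha> i))"
      unfolding left by (intro Lim_transform_eventually[OF limr]) (auto elim!: eventually_mono simp: inner)
    have "\<forall>\<^sub>F x in at_left (\<beta> i). x \<in> I i"
      using eventually_at_left_real[OF endpoint_less[of i]] by simp
    then show "(continuation f i \<longlongrightarrow> continuation f i (\<beta> i)) (at_left (\<beta> i))"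
      unfolding right by (intro Lim_transform_eventually[OF liml]) (auto elim!: eventually_mono simp: inner)
    fix x assume "\<alpha> i < x" "x < \<beta> i"
    then have x: "x \<in> I i" by simp
    then have "isCont f x"
      using uniformly_continuous_imp_continuous[OF uc[of i]] continuous_on_eq_continuous_at[OF open_greaterThanLessThan, of "\<alpha> i" "\<beta> i" f] by blast
    moreover have "\<forall>\<^sub>F y in at x. y \<in> I i"
      using x by (intro eventually_at_in_open') auto
    ultimately show "continuation f i \<midarrow>x\<rightarrow> continuation f i x"
      unfolding inner[OF x] isCont_def
      by (intro Lim_transform_eventually[where g = "continuation f i"]) (auto elim!: eventually_mono simp: inner)
  qed (rule endpoint_less)
  have steps: "continuous_on {\<alpha> i..\<alpha> i + real N * min_length} (continuation f i)" for N i
  proof (induction N arbitrary: i)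
    case (Suc N)
    have "continuous_on {\<beta> i..\<beta> i + real N * min_length}
        (\<lambda>y. \<Sum>k\<in>UNIV. B $ i $ k * continuation f k (\<alpha> k + (y - \<beta> i)))"
      by (intro continuous_intros continuous_on_compose2[OF Suc.IH]) auto
    then have "continuous_on {\<beta> i..\<beta> i + real N * min_length} (continuation f i)"
      by (rule continuous_on_eq) (simp add: continuation_long)
    with base have "continuous_on ({\<alpha> i..\<beta> i} \<union> {\<beta> i..\<beta> i + real N * min_length}) (continuation f i)"
      by (intro continuous_on_closed_Un) auto
    then show ?case
      by (rule continuous_on_subset) (use min_length_le[of i] in \<open>auto simp: algebra_simps\<close>)
  qed simp
  show ?thesis
    unfolding continuous_on_eq_continuous_within
  proof
    fix y assume y: "y \<in> {\<alpha> i..}"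
    obtain N :: nat where N: "y - \<alpha> i < real N * min_length"
      using ex_less_of_nat_mult[OF min_length_pos] by blast
    have "continuous (at y within {\<alpha> i..\<alpha> i + real N * min_length}) (continuation f i)"
      using steps[of i N] y N by (simp add: continuous_on_eq_continuous_within)
    \<comment> \<open>The strict inequality in the choice of \<open>N\<close> makes the compact
      interval and the half-line agree near \<open>y\<close>.\<close>
    moreover have "at y within {\<alpha> i..\<alpha> i + real N * min_length} = at y within {\<alpha> i..}"
      by (rule at_within_nhd[of _ "{..<\<alpha> i + real N * min_length}"]) (use N in auto)
    ultimately show "continuous (at y within {\<alpha> i..}) (continuation f i)"
      by simp
  qed
qed

text \<open>Gluing the translated continuations gives a continuous function on \<Omega> that agrees
  almost everywhere with \<open>U t f\<close>.\<close>

lemma cont_value_U: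
  assumes f: "f \<in> D_dom \<alpha> \<beta> B" and t: "t \<ge> 0" and x: "x \<in> I i"
  shows "cont_value \<Omega> (U t f) x = continuation f i (x + t)"
proof -
  let ?h = "glue (\<lambda>i x. continuation f i (x + t))"
  have "cont_value \<Omega> (U t f) x = ?h x"
  proof (rule cont_value_eqI[OF open_\<Omega>])
    show "continuous_on \<Omega> ?h"
      unfolding Omega_def
    proof (rule continuous_on_open_UN)
      fix j
      have "continuous_on (I j) (\<lambda>x. continuation f j (x + t))"
        using t by (intro continuous_on_compose2[OF continuation_continuous[OF f]] continuous_intros) auto
      then show "continuous_on (I j) ?h"
        by (rule continuous_on_eq) (simp add: glue_eq)
    qed simp
    have "f \<in> L2 \<Omega>" using f by (simp add: D_dom_def D_max_def)
    from AE_in_\<Omega> U_eq_continuation[OF this t] show "ae_eq \<Omega> ?h (U t f)"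
      unfolding ae_eq_def
    proof eventually_elim
      case (elim x)
      from elim(1) obtain j where "x \<in> I j" by (rule \<Omega>E)
      with elim(2) show ?case by (simp add: glue_eq)
    qed
    show "x \<in> \<Omega>" by (rule I_subset[OF x])
  qed
  then show ?thesis by (simp add: glue_eq[OF x])
qed

end

theorem theorem2p5:
  fixes \<alpha> \<beta> :: "'n::{finite,linorder} \<Rightarrow> real"
    and B :: "complex^('n::{finite,linorder})^('n::{finite,linorder})"
    and U :: "real \<Rightarrow> (real \<Rightarrow> complex) \<Rightarrow> (real \<Rightarrow> complex)"
  assumes "interval_system \<alpha> \<beta>"
    and "unitary_matrix B"
    and "associated_unitary_group \<alpha> \<beta> B U"
  shows
    "(\<forall>f\<in>D_dom \<alpha> \<beta> B. \<forall>t>0. \<forall>i. \<forall>x\<in>{\<alpha> i<..<\<beta> i}.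
        (t < \<beta> i - x \<longrightarrow> cont_value (Omega \<alpha> \<beta>) (U t f) x = f (x + t)) \<and>
        (t \<ge> \<beta> i - x \<longrightarrow>
           cont_value (Omega \<alpha> \<beta>) (U t f) x =
             (\<Sum>w\<in>paths \<alpha> \<beta> x t. path_weight B w *
                eval_ext (Omega \<alpha> \<beta>) f (\<alpha> (last w) + remainder \<alpha> \<beta> x t w)) \<and>
           cont_value (Omega \<alpha> \<beta>) (U t f) x =
             (\<Sum>w\<in>paths \<alpha> \<beta> x t. path_weight B w *
                eval_ext (Omega \<alpha> \<beta>) f (End \<alpha> \<beta> x t w)))) \<and>
     (\<forall>f\<in>L2 (Omega \<alpha> \<beta>). \<forall>t>0. AE x in lebesgue_on (Omega \<alpha> \<beta>).
        \<forall>i. x \<in> {\<alpha> i<..<\<beta> i} \<longrightarrow>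
        (t < \<beta> i - x \<longrightarrow> U t f x = f (x + t)) \<and>
        (t \<ge> \<beta> i - x \<longrightarrow>
           U t f x =
             (\<Sum>w\<in>paths \<alpha> \<beta> x t. path_weight B w *
                eval_ext (Omega \<alpha> \<beta>) f (\<alpha> (last w) + remainder \<alpha> \<beta> x t w)) \<and>
           U t f x =
             (\<Sum>w\<in>paths \<alpha> \<beta> x t. path_weight B w *
                eval_ext (Omega \<alpha> \<beta>) f (End \<alpha> \<beta> x t w))))"
proof -
  interpret boundary_unitary_group \<alpha> \<beta> B U
    by standard fact+
  have short: "continuation f i (x + t) = f (x + t)" if "x \<in> I i" "t > 0" "t < \<beta> i - x" for f i x t
  proof -
    have "x + t \<in> I i" using that by auto
    with I_subset[OF this] show ?thesis by (simp add: continuation_short eval_ext_def)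
  qed
  \<comment> \<open>Unfolding \<open>End\<close> makes the two forms of the path sum
    identical.\<close>
  show ?thesis
    unfolding End_def
  proof (intro conjI ballI allI impI)
    fix f t assume "f \<in> L2 \<Omega>" "(0::real) < t"
    then have "AE x in lebesgue_on \<Omega>. \<forall>i. x \<in> I i \<longrightarrow> U t f x = continuation f i (x + t)"
      by (intro U_eq_continuation) auto
    then show "AE x in lebesgue_on \<Omega>. \<forall>i. x \<in> I i \<longrightarrow>
        (t < \<beta> i - x \<longrightarrow> U t f x = f (x + t)) \<and>
        (t \<ge> \<beta> i - x \<longrightarrow>
           U t f x = (\<Sum>w\<in>paths \<alpha> \<beta> x t. path_weight B w *
                eval_ext \<Omega> f (\<alpha> (last w) + remainder \<alpha> \<beta> x t w)) \<and>
           U t f x = (\<Sum>w\<in>paths \<alpha> \<beta> x t. path_weight B w *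
                eval_ext \<Omega> f (\<alpha> (last w) + remainder \<alpha> \<beta> x t w)))"
      by eventually_elim (use \<open>0 < t\<close> in \<open>auto simp: short path_sum_eq_continuation\<close>)
  qed (simp_all only: cont_value_U less_imp_le short path_sum_eq_continuation)
qed

end
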